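(* Let $\Lambda=\{\lambda_j\}_{j\in\mathbb N}\subset[0,1)$ be a sequence of pairwise distinct points that is a finite union of Carleson sequences, let $p>0$, and let $\Lambda^p=\{\lambda_j^p\}_{j\in\mathbb N}$ (enumerated by the same index set). Then $$\operatorname{Ran}(T_\Lambda)=\operatorname{Ran}(T_{\Lambda^p})$$ as subsets of $\ell^2(\mathbb N)$. Consequently, for every finite index set $I$, $$\operatorname{Ran}(T_{\Lambda,I})=\operatorname{Ran}(T_{\Lambda^p,I})$$ as subsets of $\ell^2(I\times\mathbb N)$.
   Context: $\mathbb N=\{0,1,2,\dots\}$, $\mathbb D=\{z\in\mathbb C:|z|<1\}$. The Hardy space $H^2(\mathbb D)$ consists of all analytic functions $f(z)=\sum_{n\ge0}c_nz^n$ on $\mathbb D$ with $\sum_{n\ge 0}|c_n|^2<\infty$. For $\lambda,z\in\mathbb D$ let $\rho(\lambda,z)=\left|\frac{\lambda-z}{1-\overline\lambda z}\right|$. A (countably infinite) sequence $\{\lambda_j\}_j\subset\mathbb D$ of pairwise distinct points is a Carleson sequence if $\inf_{j}\prod_{i\ne j}\rho(\lambda_i,\lambda_j)>0$; "finite union of Carleson sequences" means that the underlying set of points is the union of finitely many Carleson sequences. Weighted evaluation operators: for an indexed sequence $\Gamma=\{\gamma_j\}_{j\in\mathbb N}\subset\mathbb D$, the operator $T_\Gamma:D(T_\Gamma)\subset H^2(\mathbb D)\to\ell^2(\mathbb N)$ is defined by $T_\Gamma\varphi=\{\sqrt{1-|\gamma_j|^2}\,\varphi(\gamma_j)\}_{j\in\mathbb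 N}$ on $D(T_\Gamma)=\{\varphi\in H^2(\mathbb D):\{\sqrt{1-|\gamma_j|^2}\,\varphi(\gamma_j)\}_{j\in\mathbb N}\in\ell^2(\mathbb N)\}$. For a finite index set $I$, $T_{\Gamma,I}:=\bigoplus_{i\in I}T_\Gamma$ with domain $\bigoplus_{i\in I}D(T_\Gamma)\subset\bigoplus_{i\in I}H^2(\mathbb D)$ and values in $\ell^2(I\times\mathbb N)$, i.e. $T_{\Gamma,I}(\varphi_i)_{i\in I}=\{\sqrt{1-|\gamma_j|^2}\,\varphi_i(\gamma_j)\}_{(i,j)\in I\times\mathbb N}$. $\operatorname{Ran}$ denotes the range. *)

theory Defs
  imports "HOL-Complex_Analysis.Complex_Analysis" "HOL-Library.FuncSet"
begin

abbreviation unit_disc :: "complex set"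
  where "unit_disc \<equiv> ball 0 1"

text \<open>Functions on a set are represented, as in \<^theory>\<open>HOL-Library.FuncSet\<close>, by total functions
  that are undefined outside that set.\<close>

definition hardy2 :: "(complex \<Rightarrow> complex) set"
  where "hardy2 = {f \<in> extensional unit_disc.
    \<exists>c :: nat \<Rightarrow> complex. (\<forall>z\<in>unit_disc. (\<lambda>n. c n * z ^ n) sums f z) \<and>
      summable (\<lambda>n. (cmod (c n))\<^sup>2)}"

definition ell2 :: "'a set \<Rightarrow> ('a \<Rightarrow> complex) set"
  where "ell2 S = {x \<in> extensional S. (\<lambda>s. (cmod (x s))\<^sup>2) summable_on S}"

definition pseudohyp :: "complex \<Rightarrow> complex \<Rightarrow> real"
  where "pseudohyp w z = cmod ((w - z) / (1 - cnj w * z))"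

text \<open>The infinite product is the limit of its partial products. These decrease and are
  nonnegative, so the limit exists. It may be 0, which is why \<^const>\<open>prodinf\<close>, which is
  unspecified for products diverging to 0, is not used.\<close>

definition carleson_seq :: "(nat \<Rightarrow> complex) \<Rightarrow> bool"
  where "carleson_seq a \<longleftrightarrow> range a \<subseteq> unit_disc \<and> inj a \<and>
    (INF j. lim (\<lambda>n. \<Prod>i\<in>{..<n} - {j}. pseudohyp (a i) (a j))) > 0"

definition finite_union_of_carleson :: "complex set \<Rightarrow> bool"
  where "finite_union_of_carleson A \<longleftrightarrow>
    (\<exists>C. finite C \<and> (\<forall>a\<in>C. carleson_seq a) \<and> A = (\<Union>a\<in>C. range a))"

definition weighted_eval :: "(nat \<Rightarrow> complex) \<Rightarrow> (complex \<Rightarrow> complex) \<Rightarrow> nat \<Rightarrow> complex"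
  where "weighted_eval \<gamma> \<phi> = (\<lambda>j. complex_of_real (sqrt (1 - (cmod (\<gamma> j))\<^sup>2)) * \<phi> (\<gamma> j))"

definition weighted_eval_dom :: "(nat \<Rightarrow> complex) \<Rightarrow> (complex \<Rightarrow> complex) set"
  where "weighted_eval_dom \<gamma> = {\<phi> \<in> hardy2. weighted_eval \<gamma> \<phi> \<in> ell2 UNIV}"

definition weighted_eval_ran :: "(nat \<Rightarrow> complex) \<Rightarrow> (nat \<Rightarrow> complex) set"
  where "weighted_eval_ran \<gamma> = weighted_eval \<gamma> ` weighted_eval_dom \<gamma>"

definition weighted_eval_sum ::
    "(nat \<Rightarrow> complex) \<Rightarrow> 'i set \<Rightarrow> ('i \<Rightarrow> complex \<Rightarrow> complex) \<Rightarrow> 'i \<times> nat \<Rightarrow> complex"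
  where "weighted_eval_sum \<gamma> I \<phi> =
    restrict (\<lambda>(i, j). weighted_eval \<gamma> (\<phi> i) j) (I \<times> UNIV)"

text \<open>As the index set is finite in all uses, the direct sum of the domains is their product.\<close>

definition weighted_eval_sum_dom ::
    "(nat \<Rightarrow> complex) \<Rightarrow> 'i set \<Rightarrow> ('i \<Rightarrow> complex \<Rightarrow> complex) set"
  where "weighted_eval_sum_dom \<gamma> I = (I \<rightarrow>\<^sub>E weighted_eval_dom \<gamma>)"

definition weighted_eval_sum_ran ::
    "(nat \<Rightarrow> complex) \<Rightarrow> 'i set \<Rightarrow> ('i \<times> nat \<Rightarrow> complex) set"
  where "weighted_eval_sum_ran \<gamma> I = weighted_eval_sum \<gamma> I ` weighted_eval_sum_dom \<gamma> I"

end

theory Submission imports Defs begin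

text \<open>
  Write \<open>\<mu>\<^sub>j = \<lambda>\<^sub>j\<^sup>p\<close> and \<open>q = 1/p\<close>. Given \<open>\<phi>\<close> in the Hardy space, a Hardy space function \<open>\<psi>\<close> is
  wanted with \<open>\<psi>(\<mu>\<^sub>j) = w(\<mu>\<^sub>j) \<phi>(\<mu>\<^sub>j\<^sup>q)\<close> for all \<open>j\<close>, where \<open>w(x)\<close> is the square root of
  \<open>(1 - x\<^sup>2\<^sup>q) / (1 - x\<^sup>2)\<close>, the quotient of the two weights. This gives one inclusion of the ranges,
  and the other one is the same statement with \<open>1/p\<close> for \<open>p\<close>. The square-summability of the
  values is part of the definition of both ranges, so it is carried over unchanged.
  The Carleson condition enters through the Blaschke condition that it implies: \<open>1 - \<mu>\<^sub>j\<close> is summable.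

  The function \<open>w(z) \<phi>(z\<^sup>q)\<close> is not analytic in the disc, but near the point 1, where the \<open>\<mu>\<^sub>j\<close>
  accumulate, it is made of functions of \<open>1 - z\<close> that are analytic at 0. The main point is
  that multiplication by \<open>1 - z\<close> can be made small as far as values at the \<open>\<mu>\<^sub>j\<close> are concerned: if
  \<open>8 \<Sum>\<^sub>j (1 - \<mu>\<^sub>j) \<le> \<epsilon>\<^sup>2\<close>, then for each \<open>f\<close> there is \<open>h\<close> with \<open>h(\<mu>\<^sub>j) = (1 - \<mu>\<^sub>j) f(\<mu>\<^sub>j)\<close> for all \<open>j\<close>
  and norm at most \<open>\<epsilon>\<close> times that of \<open>f\<close> (lemma \<open>multiply_one_minus\<close>). Iterated, this makes
  every series \<open>\<Sum>\<^sub>k (1 - \<mu>\<^sub>j)\<^sup>k F\<^sub>k(\<mu>\<^sub>j)\<close> with \<open>\<Sum>\<^sub>k \<epsilon>\<^sup>k \<parallel>F\<^sub>k\<parallel> < \<infinity>\<close> the sequence of values of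
  a Hardy space function (lemma \<open>interpolate_power_series\<close>).

  To prove \<open>multiply_one_minus\<close>, let \<open>e\<^sub>j\<close> be the normalised Szego kernel and \<open>b\<^sub>j\<close> the Blaschke factor
  of \<open>\<mu>\<^sub>j\<close>. Dividing out one zero after the other gives the Takenaka-Malmquist expansion
  \<open>f = \<gamma>\<^sub>0 e\<^sub>0 + b\<^sub>0 (\<gamma>\<^sub>1 e\<^sub>1 + b\<^sub>1 (\<dots>))\<close>, in which the coefficients satisfy \<open>\<Sum> |\<gamma>\<^sub>j|\<^sup>2 \<le> \<parallel>f\<parallel>\<^sup>2\<close>. Since
  \<open>(1 - z) e\<^sub>j = (1 - \<mu>\<^sub>j) e\<^sub>j - s\<^sub>j b\<^sub>j\<close> with \<open>s\<^sub>j\<^sup>2 = 1 - \<mu>\<^sub>j\<^sup>2\<close>, the function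
  \<open>h = \<Sum>\<^sub>j b\<^sub>0 \<cdots> b\<^sub>j\<^sub>-\<^sub>1 \<gamma>\<^sub>j ((1 - \<mu>\<^sub>j) e\<^sub>j - s\<^sub>j b\<^sub>j)\<close> has the required values, and by the Cauchy-Schwarz
  inequality its norm is at most \<open>\<Sum>\<^sub>j 2 s\<^sub>j |\<gamma>\<^sub>j| \<le> 2 (2 \<Sum>\<^sub>j (1 - \<mu>\<^sub>j))\<^sup>1\<^sup>/\<^sup>2 \<parallel>f\<parallel>\<close>.

  A tail of the sequence satisfies the smallness condition. On such a tail, \<open>\<phi>(\<mu>\<^sup>q) = \<Sum>\<^sub>n c\<^sub>n \<mu>\<^sup>q\<^sup>n\<close> is
  treated by splitting \<open>\<mu>\<^sup>q\<^sup>n\<close> into its integral power and a power with exponent in \<open>[0,1)\<close>, and by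
  expanding the latter in powers of \<open>1 - \<mu>\<close>; the binomial coefficients that occur are
  bounded by 1, and so the coefficient at each power of \<open>1 - \<mu>\<close> is a Hardy space function of bounded
  norm (lemma \<open>interpolate_composition\<close>). The weight \<open>w\<close> is a convergent power series in
  \<open>1 - \<mu>\<close> (lemma \<open>weight_power_series\<close>). The finitely many remaining values are corrected with
  functions that vanish at all \<open>\<mu>\<^sub>j\<close> but one (lemma \<open>separating_function\<close>); these come from
  \<open>multiply_one_minus\<close> as well, as \<open>(z - 1) + h\<close> with \<open>h\<close> belonging to \<open>f = 1\<close> vanishes on a tail.
\<close>

section \<open>Norm bounds in the Hardy space\<close>

text \<open>Functions enter only through their values on the disc, so a function is related to its Taylor
  coefficients by a predicate that ignores what it does elsewhere. The bounds \<open>l2_le\<close> and \<open>h2_le\<close> say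
  that the norm of a coefficient sequence, or of a function, is at most \<open>M\<close>; a uniform bound on the
  partial sums includes their convergence.\<close>

definition taylor :: "(complex \<Rightarrow> complex) \<Rightarrow> (nat \<Rightarrow> complex) \<Rightarrow> bool"
  where "taylor f c \<longleftrightarrow> (\<forall>z\<in>unit_disc. (\<lambda>n. c n * z ^ n) sums f z)"

definition l2_le :: "(nat \<Rightarrow> complex) \<Rightarrow> real \<Rightarrow> bool"
  where "l2_le c M \<longleftrightarrow> (\<forall>N. L2_set (\<lambda>n. cmod (c n)) {..<N} \<le> M)"

definition h2_le :: "(complex \<Rightarrow> complex) \<Rightarrow> real \<Rightarrow> bool"
  where "h2_le f M \<longleftrightarrow> (\<exists>c. taylor f c \<and> l2_le c M)"

lemma l2_le_nonneg: "l2_le c M \<Longrightarrow> 0 \<le> M"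
  unfolding l2_le_def by (metis L2_set_nonneg order_trans)

lemma h2_le_nonneg: "h2_le f M \<Longrightarrow> 0 \<le> M"
  unfolding h2_le_def using l2_le_nonneg by blast

lemma l2_le_partial: "l2_le c M \<Longrightarrow> (\<Sum>n<N. (cmod (c n))\<^sup>2) \<le> M\<^sup>2"
  unfolding l2_le_def L2_set_def by (auto intro: sqrt_le_D)

lemma l2_leI:
  assumes "0 \<le> M" "\<And>N. (\<Sum>n<N. (cmod (c n))\<^sup>2) \<le> M\<^sup>2"
  shows "l2_le c M"
  unfolding l2_le_def L2_set_def using assms by (auto intro: real_le_lsqrt sum_nonneg)

lemma l2_le_summable: "l2_le c M \<Longrightarrow> summable (\<lambda>n. (cmod (c n))\<^sup>2)"
  by (rule summableI_nonneg_bounded[where x = "M\<^sup>2"]) (auto simp: l2_le_partial)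

lemma l2_le_suminf: "l2_le c M \<Longrightarrow> (\<Sum>n. (cmod (c n))\<^sup>2) \<le> M\<^sup>2"
  by (rule suminf_le_const[OF l2_le_summable l2_le_partial])

lemma l2_le_coeff: assumes "l2_le c M" shows "cmod (c n) \<le> M"
proof -
  have "cmod (c n) \<le> L2_set (\<lambda>n. cmod (c n)) {..<Suc n}"
    by (rule member_le_L2_set) auto
  with assms show ?thesis unfolding l2_le_def by (meson order_trans)
qed

lemma l2_le_mono: "l2_le c M \<Longrightarrow> M \<le> M' \<Longrightarrow> l2_le c M'"
  unfolding l2_le_def by (meson order_trans)

lemma h2_le_mono: "h2_le f M \<Longrightarrow> M \<le> M' \<Longrightarrow> h2_le f M'"
  unfolding h2_le_def using l2_le_mono by blast

lemma bounded_powser: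
  fixes z :: complex
  assumes "\<And>n. cmod (c n) \<le> M" "cmod z < 1"
  shows "summable (\<lambda>n. norm (c n * z ^ n))" "cmod (\<Sum>n. c n * z ^ n) \<le> M / (1 - cmod z)"
proof -
  have g: "(\<lambda>n. M * cmod z ^ n) sums (M * (1 / (1 - cmod z)))"
    using assms by (intro sums_mult geometric_sums) auto
  have le: "norm (c n * z ^ n) \<le> M * cmod z ^ n" for n
    by (auto simp: norm_mult norm_power intro!: mult_right_mono assms)
  show s: "summable (\<lambda>n. norm (c n * z ^ n))"
    by (rule summable_comparison_test'[OF sums_summable[OF g], of 0]) (use le in auto)
  have "cmod (\<Sum>n. c n * z ^ n) \<le> (\<Sum>n. norm (c n * z ^ n))"
    by (rule summable_norm[OF s])
  also have "\<dots> \<le> (\<Sum>n. M * cmod z ^ n)"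
    by (rule suminf_le[OF le s sums_summable[OF g]])
  finally show "cmod (\<Sum>n. c n * z ^ n) \<le> M / (1 - cmod z)"
    using sums_unique[OF g] by simp
qed

lemma taylor_suminf:
  assumes "\<And>n. cmod (c n) \<le> M"
  shows "taylor (\<lambda>z. \<Sum>n. c n * z ^ n) c"
  unfolding taylor_def
  using summable_sums[OF summable_norm_cancel[OF bounded_powser(1)[where c = c, OF assms]]] by auto

text \<open>Point evaluations are continuous. The sharp constant is \<open>(1 - |z|\<^sup>2)\<close> to the power \<open>-1/2\<close>; this
  one follows already from the boundedness of the coefficients.\<close>

lemma h2_le_eval:
  assumes "h2_le f M" "cmod z < 1"
  shows "cmod (f z) \<le> M / (1 - cmod z)"
proof -
  obtain c where c: "taylor f c" "l2_le c M" using assms unfolding h2_le_def by blast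
  have "f z = (\<Sum>n. c n * z ^ n)"
    using c(1) assms(2) unfolding taylor_def by (auto intro: sums_unique)
  then show ?thesis using bounded_powser(2)[where c = c, OF l2_le_coeff[OF c(2)] assms(2)] by simp
qed

lemma l2_le_add: assumes "l2_le c M" "l2_le d K" shows "l2_le (\<lambda>n. c n + d n) (M + K)"
  unfolding l2_le_def
proof
  fix N
  have "L2_set (\<lambda>n. cmod (c n + d n)) {..<N} \<le> L2_set (\<lambda>n. cmod (c n) + cmod (d n)) {..<N}"
    by (rule L2_set_mono) (auto simp: norm_triangle_ineq)
  also have "\<dots> \<le> L2_set (\<lambda>n. cmod (c n)) {..<N} + L2_set (\<lambda>n. cmod (d n)) {..<N}"
    by (rule L2_set_triangle_ineq)
  also have "\<dots> \<le> M + K" using assms unfolding l2_le_def by (intro add_mono) auto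
  finally show "L2_set (\<lambda>n. cmod (c n + d n)) {..<N} \<le> M + K" .
qed

lemma l2_le_cmult: assumes "l2_le c M" shows "l2_le (\<lambda>n. w * c n) (cmod w * M)"
  using assms unfolding l2_le_def
  by (auto simp: norm_mult L2_set_right_distrib[symmetric] intro: mult_left_mono)

lemma h2_le_cong:
  assumes "h2_le f M" "\<And>z. z \<in> unit_disc \<Longrightarrow> f z = g z" shows "h2_le g M"
proof -
  obtain c where "taylor f c" "l2_le c M" using assms(1) unfolding h2_le_def by blast
  moreover from this(1) have "taylor g c" using assms(2) unfolding taylor_def by simp
  ultimately show ?thesis unfolding h2_le_def by blast
qed

lemma h2_le_add: assumes "h2_le f M" "h2_le g K" shows "h2_le (\<lambda>z. f z + g z) (M + K)"
proof -
  obtain c d where "taylor f c" "l2_le c M" "taylor g d" "l2_le d K"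
    using assms unfolding h2_le_def by blast
  then show ?thesis unfolding h2_le_def
    by (intro exI[of _ "\<lambda>n. c n + d n"] conjI l2_le_add)
       (auto simp: taylor_def distrib_right intro: sums_add)
qed

lemma h2_le_cmult: assumes "h2_le f M" shows "h2_le (\<lambda>z. w * f z) (cmod w * M)"
proof -
  obtain c where "taylor f c" "l2_le c M"
    using assms unfolding h2_le_def by blast
  then show ?thesis unfolding h2_le_def
    by (intro exI[of _ "\<lambda>n. w * c n"] conjI l2_le_cmult)
       (auto simp: taylor_def mult.assoc intro: sums_mult)
qed

lemma h2_le_zero: "h2_le (\<lambda>z. 0) 0"
  unfolding h2_le_def by (intro exI[of _ "\<lambda>n. 0"]) (auto simp: taylor_def l2_le_def L2_set_def)

lemma h2_le_sum:
  assumes "\<And>i. i \<in> A \<Longrightarrow> h2_le (f i) (M i)"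
  shows "h2_le (\<lambda>z. \<Sum>i\<in>A. f i z) (\<Sum>i\<in>A. M i)"
  using assms by (induction A rule: infinite_finite_induct) (auto intro: h2_le_zero h2_le_add)

lemma taylor_shift: assumes "taylor f c" shows "taylor (\<lambda>z. z * f z) (case_nat 0 c)"
  unfolding taylor_def
proof
  fix z :: complex assume "z \<in> unit_disc"
  then have "(\<lambda>n. c n * z ^ n) sums f z" using assms unfolding taylor_def by blast
  then have "(\<lambda>n. z * (c n * z ^ n)) sums (z * f z)" by (rule sums_mult)
  then have "(\<lambda>n. case_nat 0 c (Suc n) * z ^ Suc n) sums (z * f z)" by (simp add: algebra_simps)
  then show "(\<lambda>n. case_nat 0 c n * z ^ n) sums (z * f z)"
    using sums_Suc[where f = "\<lambda>n. case_nat 0 c n * z ^ n" and l = "z * f z"] by simp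
qed

lemma h2_le_shift: assumes "h2_le f M" shows "h2_le (\<lambda>z. z * f z) M"
proof -
  obtain c where c: "taylor f c" "l2_le c M" using assms unfolding h2_le_def by blast
  have "l2_le (case_nat 0 c) M"
  proof (rule l2_leI[OF l2_le_nonneg[OF c(2)]])
    fix N show "(\<Sum>n<N. (cmod (case_nat 0 c n))\<^sup>2) \<le> M\<^sup>2"
      using l2_le_partial[OF c(2)] by (cases N) (auto simp: sum.lessThan_Suc_shift simp del: sum.lessThan_Suc)
  qed
  with taylor_shift[OF c(1)] show ?thesis unfolding h2_le_def by blast
qed

lemma h2_le_linear_factor:
  assumes "h2_le f M" shows "h2_le (\<lambda>z. (z - a) * f z) (M + cmod a * M)"
  by (rule h2_le_cong[OF h2_le_add[OF h2_le_shift[OF assms] h2_le_cmult[OF assms, of "-a"], simplified]])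
     (simp add: algebra_simps)

lemma h2_le_one: "h2_le (\<lambda>z. 1) 1"
proof -
  have "taylor (\<lambda>z. 1) (\<lambda>n. if n = 0 then 1 else 0)"
    unfolding taylor_def
  proof
    fix z :: complex
    show "(\<lambda>n. (if n = 0 then 1 else 0) * z ^ n) sums 1"
      using powser_sums_zero_iff[of "\<lambda>n. if n = 0 then 1 else 0 :: complex" 1]
        sums_If_finite_set[of "{0::nat}" "\<lambda>n. z ^ n"] by (simp add: if_distrib[of "\<lambda>x. x * _"] cong: if_cong)
  qed
  moreover have "l2_le (\<lambda>n. if n = 0 then 1 else 0) 1"
  proof (rule l2_leI)
    fix N :: nat
    show "(\<Sum>n<N. (cmod (if n = 0 then 1 else 0))\<^sup>2) \<le> 1\<^sup>2"
      by (cases N) (auto simp: sum.lessThan_Suc_shift simp del: sum.lessThan_Suc)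
  qed simp
  ultimately show ?thesis unfolding h2_le_def by blast
qed

text \<open>Completeness of the Hardy space, in the form that absolutely convergent series converge, together
  with the continuity of evaluations, which makes the sum the pointwise one.\<close>

lemma h2_le_series:
  assumes f: "\<And>k. h2_le (f k) (M k)" and M: "summable M"
  shows "\<exists>g. h2_le g (\<Sum>k. M k) \<and> (\<forall>z\<in>unit_disc. (\<lambda>k. f k z) sums g z)"
proof -
  have M0: "0 \<le> M k" for k using f h2_le_nonneg by blast
  obtain c where c: "\<And>k. taylor (f k) (c k)" "\<And>k. l2_le (c k) (M k)"
    using f unfolding h2_le_def by metis
  have sc: "summable (\<lambda>k. c k n)" for n
    by (rule summable_comparison_test'[OF M, of 0]) (use c l2_le_coeff in auto)
  define C where "C n = (\<Sum>k. c k n)" for n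
  have bound: "l2_le (\<lambda>n. \<Sum>k. c (k + m) n) (\<Sum>k. M (k + m))" for m
    unfolding l2_le_def
  proof
    fix N
    have sM: "summable (\<lambda>k. M (k + m))" by (rule summable_ignore_initial_segment[OF M])
    have le: "l2_le (\<lambda>n. \<Sum>k<K. c (k + m) n) (\<Sum>k<K. M (k + m))" for K
    proof (induction K)
      case 0
      show ?case by (simp add: l2_le_def L2_set_def)
    next
      case (Suc K)
      from l2_le_add[OF Suc c(2)[of "K + m"]] show ?case by simp
    qed
    have "(\<lambda>K. L2_set (\<lambda>n. cmod (\<Sum>k<K. c (k + m) n)) {..<N})
        \<longlonglongrightarrow> L2_set (\<lambda>n. cmod (\<Sum>k. c (k + m) n)) {..<N}"
      unfolding L2_set_def
      by (intro tendsto_intros summable_LIMSEQ summable_ignore_initial_segment sc)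
    moreover have "L2_set (\<lambda>n. cmod (\<Sum>k<K. c (k + m) n)) {..<N} \<le> (\<Sum>k. M (k + m))" for K
      using le[of K] sum_le_suminf[OF sM, of "{..<K}"] M0 unfolding l2_le_def
      by (meson finite_lessThan order_trans)
    ultimately show "L2_set (\<lambda>n. cmod (\<Sum>k. c (k + m) n)) {..<N} \<le> (\<Sum>k. M (k + m))"
      by (meson LIMSEQ_le_const2)
  qed
  have C: "l2_le C (\<Sum>k. M k)" using bound[of 0] by (simp add: C_def[abs_def])
  define g where "g z = (\<Sum>n. C n * z ^ n)" for z
  have tg: "taylor g C" unfolding g_def using taylor_suminf l2_le_coeff[OF C] by blast
  have "(\<lambda>k. f k z) sums g z" if z: "z \<in> unit_disc" for z
  proof -
    have z1: "cmod z < 1" using z by simp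
    \<comment> \<open>The remainder of the series is again a series of the same kind, with the norm bound of its tail.\<close>
    have le: "cmod ((\<Sum>k<m. f k z) - g z) \<le> (\<Sum>k. M (k + m)) / (1 - cmod z)" for m
    proof -
      have "(\<lambda>n. \<Sum>k<m. c k n * z ^ n) sums (\<Sum>k<m. f k z)"
        using c(1) z unfolding taylor_def by (intro sums_sum) auto
      then have "(\<lambda>n. C n * z ^ n - (\<Sum>k<m. c k n * z ^ n)) sums (g z - (\<Sum>k<m. f k z))"
        using tg z unfolding taylor_def by (intro sums_diff) auto
      moreover have "C n * z ^ n - (\<Sum>k<m. c k n * z ^ n) = (\<Sum>k. c (k + m) n) * z ^ n" for n
        using suminf_split_initial_segment[OF sc[of n], of m]
        by (simp add: C_def algebra_simps sum_distrib_left)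
      ultimately have "g z - (\<Sum>k<m. f k z) = (\<Sum>n. (\<Sum>k. c (k + m) n) * z ^ n)"
        using sums_unique by simp
      then show ?thesis
        using bounded_powser(2)[where c = "\<lambda>n. \<Sum>k. c (k + m) n", OF l2_le_coeff[OF bound[of m]] z1]
        by (simp add: norm_minus_commute)
    qed
    have "(\<lambda>m. \<Sum>k. M (k + m)) \<longlonglongrightarrow> 0" by (rule suminf_exist_split2[OF M])
    then have "(\<lambda>m. (\<Sum>k. M (k + m)) / (1 - cmod z)) \<longlonglongrightarrow> 0" by (rule tendsto_divide_zero)
    then have "(\<lambda>m. (\<Sum>k<m. f k z) - g z) \<longlonglongrightarrow> 0"
      by (rule Lim_null_comparison[rotated]) (use le in auto)
    then show ?thesis unfolding sums_def by (rule LIM_zero_cancel)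
  qed
  moreover have "h2_le g (\<Sum>k. M k)" using tg C unfolding h2_le_def by blast
  ultimately show ?thesis by blast
qed

section \<open>Blaschke factors and the Szego kernel\<close>

text \<open>If \<open>d\<close> are the Taylor coefficients of \<open>g\<close>, then those of \<open>(z - a) g\<close> and of \<open>(1 - a z) g\<close> are compared
  here. In the limit the two functions have the same norm, which is why multiplication by
  a Blaschke factor is isometric; the finite version, with its boundary term, gives both directions.\<close>

lemma blaschke_telescope:
  fixes d D :: "nat \<Rightarrow> complex" and a :: real
  defines "D \<equiv> case_nat 0 d"
  shows "(\<Sum>n<N. (cmod (D n - a * d n))\<^sup>2) + (1 - a\<^sup>2) * (cmod (D N))\<^sup>2
       = (\<Sum>n<N. (cmod (d n - a * D n))\<^sup>2)"
proof (induction N)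
  case 0
  show ?case by (simp add: D_def)
next
  case (Suc N)
  have "(cmod (x - a * y))\<^sup>2 + (1 - a\<^sup>2) * (cmod y)\<^sup>2 = (cmod (y - a * x))\<^sup>2 + (1 - a\<^sup>2) * (cmod x)\<^sup>2"
    for x y :: complex
    unfolding cmod_power2 by (simp add: power2_eq_square algebra_simps)
  from this[of "D N" "d N"] Suc show ?case by (simp add: D_def)
qed

definition blaschke :: "real \<Rightarrow> complex \<Rightarrow> complex"
  where "blaschke a z = (z - of_real a) / (1 - of_real a * z)"

text \<open>The Szego kernel at \<open>a\<close>, normalised to norm 1.\<close>

definition szego :: "real \<Rightarrow> complex \<Rightarrow> complex"
  where "szego a z = of_real (sqrt (1 - a\<^sup>2)) / (1 - of_real a * z)"

lemma one_minus_mult_nonzero: "0 \<le> a \<Longrightarrow> a < 1 \<Longrightarrow> cmod z < 1 \<Longrightarrow> 1 - complex_of_real a * z \<noteq> 0"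
proof
  assume a: "0 \<le> a" "a < 1" "cmod z < 1" and "1 - complex_of_real a * z = 0"
  then have "cmod (complex_of_real a * z) = 1" by simp
  then have "a * cmod z = 1" using a by (simp add: norm_mult)
  moreover have "a * cmod z \<le> 1 * cmod z" using a by (intro mult_right_mono) auto
  ultimately show False using a by linarith
qed

lemma taylor_quotient:
  assumes a: "0 \<le> a" "a < 1" and f: "taylor f c" and c: "\<And>n. cmod (c n) \<le> M"
  shows "taylor (\<lambda>z. f z / (1 - complex_of_real a * z)) (\<lambda>n. \<Sum>i\<le>n. of_real a ^ i * c (n - i))"
  unfolding taylor_def
proof
  fix z :: complex assume z: "z \<in> unit_disc"
  have az: "cmod (of_real a * z) < 1"
  proof -
    have "a * cmod z \<le> 1 * cmod z" using a by (intro mult_right_mono) auto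
    then show ?thesis using a z by (simp add: norm_mult)
  qed
  have g: "(\<lambda>i. (of_real a * z) ^ i) sums (1 / (1 - of_real a * z))"
    by (rule geometric_sums[OF az])
  have "(\<lambda>n. \<Sum>i\<le>n. (of_real a * z) ^ i * (c (n - i) * z ^ (n - i))) sums
     ((\<Sum>i. (of_real a * z) ^ i) * (\<Sum>n. c n * z ^ n))"
    using az z by (intro Cauchy_product_sums bounded_powser(1)[where c = c, OF c])
      (auto simp: norm_power intro: summable_geometric)
  moreover have "(\<Sum>n. c n * z ^ n) = f z"
    using f z unfolding taylor_def by (auto intro: sums_unique[symmetric])
  moreover have "(\<Sum>i\<le>n. (of_real a * z) ^ i * (c (n - i) * z ^ (n - i)))
      = (\<Sum>i\<le>n. of_real a ^ i * c (n - i)) * z ^ n" for n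
    unfolding sum_distrib_right
  proof (rule sum.cong[OF refl])
    fix i assume "i \<in> {..n}"
    then have "z ^ n = z ^ i * z ^ (n - i)" by (simp flip: power_add)
    then show "(of_real a * z) ^ i * (c (n - i) * z ^ (n - i)) = of_real a ^ i * c (n - i) * z ^ n"
      by (simp add: power_mult_distrib)
  qed
  ultimately show "(\<lambda>n. (\<Sum>i\<le>n. of_real a ^ i * c (n - i)) * z ^ n) sums (f z / (1 - of_real a * z))"
    using sums_unique[OF g, symmetric] by (simp add: divide_inverse mult.commute)
qed

text \<open>With \<open>g = f / (1 - a z)\<close>, the product of \<open>f\<close> and the Blaschke factor is \<open>(z - a) g\<close> while \<open>f\<close> itself is
  \<open>(1 - a z) g\<close>, so \<open>blaschke_telescope\<close> compares their coefficients, its boundary term having the right sign.\<close>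

lemma h2_le_blaschke:
  assumes a: "0 \<le> a" "a < 1" and f: "h2_le f M"
  shows "h2_le (\<lambda>z. blaschke a z * f z) M"
proof -
  obtain c where c: "taylor f c" "l2_le c M" using f unfolding h2_le_def by blast
  define d where "d n = (\<Sum>i\<le>n. of_real a ^ i * c (n - i))" for n
  define D where "D = case_nat 0 d"
  define g where "g z = f z / (1 - complex_of_real a * z)" for z
  have g: "taylor g d"
    unfolding d_def g_def by (rule taylor_quotient[OF a c(1) l2_le_coeff[OF c(2)]])
  have D: "taylor (\<lambda>z. z * g z) D" unfolding D_def by (rule taylor_shift[OF g])
  have "taylor (\<lambda>z. blaschke a z * f z) (\<lambda>n. D n - a * d n)"
    unfolding taylor_def
  proof
    fix z :: complex assume z: "z \<in> unit_disc"
    then have "(\<lambda>n. D n * z ^ n - a * (d n * z ^ n)) sums (z * g z - a * g z)"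
      using g D unfolding taylor_def by (intro sums_diff sums_mult) auto
    then show "(\<lambda>n. (D n - a * d n) * z ^ n) sums (blaschke a z * f z)"
      by (simp add: algebra_simps g_def blaschke_def diff_divide_distrib)
  qed
  moreover have "l2_le (\<lambda>n. D n - a * d n) M"
  proof (rule l2_leI[OF l2_le_nonneg[OF c(2)]])
    fix N
    have c_eq: "d n - a * D n = c n" for n
    proof (cases n)
      case (Suc m)
      have "d (Suc m) = c (Suc m) + a * d m"
        unfolding d_def by (subst sum.atMost_Suc_shift) (simp add: sum_distrib_left mult_ac)
      then show ?thesis using Suc by (simp add: D_def)
    qed (simp add: D_def d_def)
    have "0 \<le> (1 - a\<^sup>2) * (cmod (D N))\<^sup>2" using a by (simp add: power_le_one)
    then have "(\<Sum>n<N. (cmod (D n - a * d n))\<^sup>2) \<le> (\<Sum>n<N. (cmod (d n - a * D n))\<^sup>2)"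
      using blaschke_telescope[where d = d and N = N and a = a] unfolding D_def by linarith
    also have "\<dots> \<le> M\<^sup>2" unfolding c_eq by (rule l2_le_partial[OF c(2)])
    finally show "(\<Sum>n<N. (cmod (D n - a * d n))\<^sup>2) \<le> M\<^sup>2" .
  qed
  ultimately show ?thesis unfolding h2_le_def by blast
qed

lemma szego_coeffs:
  assumes a: "0 \<le> a" "a < 1"
  shows "taylor (szego a) (\<lambda>n. of_real (sqrt (1 - a\<^sup>2) * a ^ n))"
    and "(\<lambda>n. (sqrt (1 - a\<^sup>2) * a ^ n)\<^sup>2) sums 1"
proof -
  show "taylor (szego a) (\<lambda>n. of_real (sqrt (1 - a\<^sup>2) * a ^ n))"
    unfolding taylor_def
  proof
    fix z :: complex assume z: "z \<in> unit_disc"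
    have "a * cmod z \<le> 1 * cmod z" using a by (intro mult_right_mono) auto
    then have "cmod (of_real a * z) < 1" using a z by (simp add: norm_mult)
    from sums_mult[OF geometric_sums[OF this], of "of_real (sqrt (1 - a\<^sup>2))"]
    show "(\<lambda>n. of_real (sqrt (1 - a\<^sup>2) * a ^ n) * z ^ n) sums szego a z"
      by (simp add: szego_def power_mult_distrib mult_ac)
  qed
  have a2: "a\<^sup>2 < 1" using a by (simp add: power_less_one_iff)
  then have "(\<lambda>n. (1 - a\<^sup>2) * (a\<^sup>2) ^ n) sums ((1 - a\<^sup>2) * (1 / (1 - a\<^sup>2)))"
    by (intro sums_mult geometric_sums) auto
  moreover have "(sqrt (1 - a\<^sup>2) * a ^ n)\<^sup>2 = (1 - a\<^sup>2) * (a\<^sup>2) ^ n" for n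
    using a2 by (simp add: power_mult_distrib power_mult[symmetric] mult.commute)
  ultimately show "(\<lambda>n. (sqrt (1 - a\<^sup>2) * a ^ n)\<^sup>2) sums 1" using a2 by simp
qed

lemma h2_le_szego: assumes a: "0 \<le> a" "a < 1" shows "h2_le (szego a) 1"
proof -
  have "l2_le (\<lambda>n. of_real (sqrt (1 - a\<^sup>2) * a ^ n)) 1"
  proof (rule l2_leI)
    fix N
    have "(\<Sum>n<N. (sqrt (1 - a\<^sup>2) * a ^ n)\<^sup>2) \<le> (\<Sum>n. (sqrt (1 - a\<^sup>2) * a ^ n)\<^sup>2)"
      using szego_coeffs(2)[OF a] by (intro sum_le_suminf) (auto intro: sums_summable)
    then show "(\<Sum>n<N. (cmod (of_real (sqrt (1 - a\<^sup>2) * a ^ n)))\<^sup>2) \<le> 1\<^sup>2"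
      using sums_unique[OF szego_coeffs(2)[OF a]] by (simp only: norm_of_real power2_abs) simp
  qed simp
  with szego_coeffs(1)[OF a] show ?thesis unfolding h2_le_def by blast
qed

text \<open>The converse of \<open>h2_le_blaschke\<close>: a zero can be divided out without increasing the norm. The
  boundary term in \<open>blaschke_telescope\<close> now has the wrong sign, but it tends to 0 because the
  coefficients \<open>d\<close> of \<open>f / (z - a)\<close> do.\<close>

lemma h2_le_divide_zero:
  assumes a: "0 \<le> a" "a < 1" and f: "h2_le f M" and zero: "f a = 0"
  shows "\<exists>g. h2_le g M \<and> (\<forall>z\<in>unit_disc. f z = blaschke a z * g z)"
proof -
  obtain u where u: "taylor f u" "l2_le u M" using f unfolding h2_le_def by blast
  define A where "A = complex_of_real a"
  have A: "cmod A < 1" using a by (simp add: A_def)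
  have su: "summable (\<lambda>k. norm (u (k + n) * A ^ k))" for n
    by (rule bounded_powser(1)[where c = "\<lambda>k. u (k + n)", OF l2_le_coeff[OF u(2)] A])
  \<comment> \<open>Of the solutions of the recursion for the coefficients of \<open>f / (z - a)\<close>, which for \<open>a > 0\<close> differ by multiples
    of \<open>a\<close> to the power \<open>-n\<close>, this is the bounded one. It starts correctly because of \<open>f a = 0\<close>.\<close>
  define d where "d n = (\<Sum>k. u (k + Suc n) * A ^ k)" for n
  define D where "D = case_nat 0 d"
  have split: "(\<Sum>k. u (k + n) * A ^ k) = u n + A * d n" for n
  proof -
    have "(\<Sum>k. u (k + n) * A ^ k) = u n + (\<Sum>k. u (Suc k + n) * A ^ Suc k)"
      using suminf_split_head[OF summable_norm_cancel[OF su[of n]]] by simp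
    also have "(\<Sum>k. u (Suc k + n) * A ^ Suc k) = (\<Sum>k. A * (u (k + Suc n) * A ^ k))"
      by (simp add: mult_ac)
    also have "\<dots> = A * d n"
      unfolding d_def by (rule suminf_mult[OF summable_norm_cancel[OF su]])
    finally show ?thesis .
  qed
  have u_eq: "D n - A * d n = u n" for n
  proof (cases n)
    case 0
    have "(\<lambda>n. u n * A ^ n) sums f A" using u(1) A unfolding taylor_def by auto
    then have "(\<Sum>k. u k * A ^ k) = 0" using zero sums_unique unfolding A_def by fastforce
    then show ?thesis using split[of 0] 0 by (simp add: D_def add_eq_0_iff2)
  next
    case (Suc m)
    show ?thesis using split[of n] unfolding D_def Suc by (simp add: d_def)
  qed
  have d_le: "cmod (d n) \<le> B / (1 - a)" if "\<And>k. n < k \<Longrightarrow> cmod (u k) \<le> B" for n B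
    using bounded_powser(2)[where c = "\<lambda>k. u (k + Suc n)" and M = B, OF that A] a
    unfolding d_def A_def by auto
  have d_bound: "cmod (d n) \<le> M / (1 - a)" for n
    by (rule d_le) (rule l2_le_coeff[OF u(2)])
  have d_lim: "d \<longlonglongrightarrow> 0"
  proof (rule LIMSEQ_I)
    fix r :: real assume r: "0 < r"
    have "(\<lambda>n. (cmod (u n))\<^sup>2) \<longlonglongrightarrow> 0" by (rule summable_LIMSEQ_zero[OF l2_le_summable[OF u(2)]])
    then have "(\<lambda>n. sqrt ((cmod (u n))\<^sup>2)) \<longlonglongrightarrow> sqrt 0" by (rule tendsto_real_sqrt)
    then have "(\<lambda>n. cmod (u n)) \<longlonglongrightarrow> 0" by simp
    then obtain n0 where n0: "\<And>n. n \<ge> n0 \<Longrightarrow> cmod (u n) < r * (1 - a) / 2"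
      using LIMSEQ_D[of "\<lambda>n. cmod (u n)" 0 "r * (1 - a) / 2"] r a by auto
    have "norm (d n - 0) < r" if "n \<ge> n0" for n
    proof -
      have "cmod (d n) \<le> (r * (1 - a) / 2) / (1 - a)"
        by (rule d_le) (use n0 that in \<open>auto intro!: less_imp_le\<close>)
      also have "\<dots> = r / 2" using a by (simp add: field_simps)
      finally show ?thesis using r by simp
    qed
    then show "\<exists>no. \<forall>n\<ge>no. norm (d n - 0) < r" by blast
  qed
  define g where "g z = (\<Sum>n. d n * z ^ n)" for z
  have g: "taylor g d" unfolding g_def using taylor_suminf d_bound by blast
  have D: "taylor (\<lambda>z. z * g z) D" unfolding D_def by (rule taylor_shift[OF g])
  define v where "v n = d n - A * D n" for n
  have v: "taylor (\<lambda>z. (1 - A * z) * g z) v"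
    unfolding taylor_def
  proof
    fix z :: complex assume z: "z \<in> unit_disc"
    then have "(\<lambda>n. d n * z ^ n - A * (D n * z ^ n)) sums (g z - A * (z * g z))"
      using g D unfolding taylor_def by (intro sums_diff sums_mult) auto
    then show "(\<lambda>n. v n * z ^ n) sums ((1 - A * z) * g z)"
      by (simp add: algebra_simps v_def)
  qed
  have "l2_le v M"
  proof (rule l2_leI[OF l2_le_nonneg[OF u(2)]])
    fix N
    have D_lim: "(\<lambda>n. D n) \<longlonglongrightarrow> 0" unfolding D_def
      by (rule LIMSEQ_imp_Suc) (simp add: d_lim)
    have lim: "(\<lambda>m. M\<^sup>2 + (1 - a\<^sup>2) * (cmod (D m))\<^sup>2) \<longlonglongrightarrow> M\<^sup>2 + (1 - a\<^sup>2) * (cmod 0)\<^sup>2"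
      by (intro tendsto_intros D_lim)
    have "(\<Sum>n<N. (cmod (v n))\<^sup>2) \<le> M\<^sup>2 + (1 - a\<^sup>2) * (cmod (D m))\<^sup>2" if "m \<ge> N" for m
    proof -
      have "(\<Sum>n<N. (cmod (v n))\<^sup>2) \<le> (\<Sum>n<m. (cmod (v n))\<^sup>2)"
        using that by (intro sum_mono2) auto
      also have "\<dots> = (\<Sum>n<m. (cmod (u n))\<^sup>2) + (1 - a\<^sup>2) * (cmod (D m))\<^sup>2"
        using blaschke_telescope[where d = d and N = m and a = a] u_eq
        unfolding D_def v_def A_def by simp
      finally show ?thesis using l2_le_partial[OF u(2), of m] by linarith
    qed
    then have "(\<Sum>n<N. (cmod (v n))\<^sup>2) \<le> M\<^sup>2 + (1 - a\<^sup>2) * (cmod 0)\<^sup>2"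
      by (intro LIMSEQ_le_const[OF lim]) blast
    then show "(\<Sum>n<N. (cmod (v n))\<^sup>2) \<le> M\<^sup>2" by simp
  qed
  moreover have "f z = blaschke a z * ((1 - A * z) * g z)" if z: "z \<in> unit_disc" for z
  proof -
    have "(\<lambda>n. D n * z ^ n - A * (d n * z ^ n)) sums (z * g z - A * g z)"
      using g D z unfolding taylor_def by (intro sums_diff sums_mult) auto
    then have "(\<lambda>n. u n * z ^ n) sums ((z - A) * g z)"
      by (simp add: u_eq[symmetric] algebra_simps)
    then have "f z = (z - A) * g z" using u(1) z sums_unique2 unfolding taylor_def by blast
    then show ?thesis using one_minus_mult_nonzero[OF a, of z] z by (simp add: blaschke_def A_def)
  qed
  ultimately show ?thesis using v unfolding h2_le_def by blast
qed

text \<open>The first summand is the orthogonal projection of \<open>f\<close> to the Szego kernel, since the inner product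
  of \<open>f\<close> with \<open>szego a\<close> is a multiple of \<open>f a\<close>. The rest vanishes at \<open>a\<close>, and Pythagoras bounds it.\<close>

lemma szego_decomposition:
  assumes a: "0 \<le> a" "a < 1" and f: "h2_le f M"
  shows "\<exists>\<gamma> g K. h2_le g K \<and> (cmod \<gamma>)\<^sup>2 + K\<^sup>2 \<le> M\<^sup>2 \<and>
    (\<forall>z\<in>unit_disc. f z = \<gamma> * szego a z + blaschke a z * g z)"
proof -
  obtain c where c: "taylor f c" "l2_le c M" using f unfolding h2_le_def by blast
  define s where "s = sqrt (1 - a\<^sup>2)"
  have a2: "a\<^sup>2 < 1" using a by (simp add: power_less_one_iff)
  have s2: "s\<^sup>2 = 1 - a\<^sup>2" using a2 by (simp add: s_def)
  define e where "e n = s * a ^ n" for n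
  define \<gamma> where "\<gamma> = s * f a"
  define u where "u n = c n - \<gamma> * e n" for n
  have e: "taylor (szego a) (\<lambda>n. of_real (e n))" "(\<lambda>n. (e n)\<^sup>2) sums 1"
    using szego_coeffs[OF a] unfolding e_def s_def by auto
  have u: "taylor (\<lambda>z. f z - \<gamma> * szego a z) u"
    unfolding taylor_def
  proof
    fix z :: complex assume z: "z \<in> unit_disc"
    then have "(\<lambda>n. c n * z ^ n - \<gamma> * (of_real (e n) * z ^ n)) sums (f z - \<gamma> * szego a z)"
      using c(1) e(1) unfolding taylor_def by (intro sums_diff sums_mult) auto
    then show "(\<lambda>n. u n * z ^ n) sums (f z - \<gamma> * szego a z)"
      by (simp add: algebra_simps u_def)
  qed
  have "(\<lambda>n. c n * of_real a ^ n) sums f a" using c(1) a unfolding taylor_def by auto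
  then have "(\<lambda>n. of_real s * (c n * of_real a ^ n)) sums \<gamma>" unfolding \<gamma>_def by (rule sums_mult)
  then have ce: "(\<lambda>n. c n * e n) sums \<gamma>" by (simp add: e_def mult_ac)
  have "(\<lambda>n. Re (cnj \<gamma> * (c n * e n))) sums Re (cnj \<gamma> * \<gamma>)"
    by (intro sums_Re sums_mult ce)
  then have re: "(\<lambda>n. Re (cnj \<gamma> * (c n * e n))) sums (cmod \<gamma>)\<^sup>2"
    unfolding cmod_power2 by (simp add: power2_eq_square)
  have "(\<lambda>n. (cmod (c n))\<^sup>2 - 2 * Re (cnj \<gamma> * (c n * e n)) + (cmod \<gamma>)\<^sup>2 * (e n)\<^sup>2)
      sums ((\<Sum>n. (cmod (c n))\<^sup>2) - 2 * (cmod \<gamma>)\<^sup>2 + (cmod \<gamma>)\<^sup>2 * 1)"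
    by (intro sums_add sums_diff sums_mult re e(2) summable_sums l2_le_summable[OF c(2)])
  moreover have "(cmod (u n))\<^sup>2 = (cmod (c n))\<^sup>2 - 2 * Re (cnj \<gamma> * (c n * e n)) + (cmod \<gamma>)\<^sup>2 * (e n)\<^sup>2" for n
    unfolding u_def by (simp add: cmod_power2) (simp add: power2_eq_square algebra_simps)
  ultimately have us: "(\<lambda>n. (cmod (u n))\<^sup>2) sums ((\<Sum>n. (cmod (c n))\<^sup>2) - (cmod \<gamma>)\<^sup>2)" by simp
  define K where "K = sqrt ((\<Sum>n. (cmod (c n))\<^sup>2) - (cmod \<gamma>)\<^sup>2)"
  have "0 \<le> (\<Sum>n. (cmod (u n))\<^sup>2)" using us by (intro suminf_nonneg) (auto simp: sums_iff)
  then have K0: "0 \<le> (\<Sum>n. (cmod (c n))\<^sup>2) - (cmod \<gamma>)\<^sup>2" using sums_unique[OF us] by simp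
  then have K2: "(cmod \<gamma>)\<^sup>2 + K\<^sup>2 \<le> M\<^sup>2" unfolding K_def using l2_le_suminf[OF c(2)] by simp
  have "l2_le u K"
  proof (rule l2_leI)
    fix N
    have "(\<Sum>n<N. (cmod (u n))\<^sup>2) \<le> (\<Sum>n. (cmod (u n))\<^sup>2)"
      using us by (intro sum_le_suminf) (auto simp: sums_iff)
    then show "(\<Sum>n<N. (cmod (u n))\<^sup>2) \<le> K\<^sup>2" using sums_unique[OF us] K0 by (simp add: K_def)
  qed (use K0 in \<open>simp add: K_def\<close>)
  with u have hu: "h2_le (\<lambda>z. f z - \<gamma> * szego a z) K" unfolding h2_le_def by blast
  have "szego a a = s / (1 - a\<^sup>2)" by (simp add: szego_def s_def power2_eq_square)
  then have "\<gamma> * szego a a = of_real (s\<^sup>2 / (1 - a\<^sup>2)) * f a" by (simp add: \<gamma>_def power2_eq_square)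
  then have "f a - \<gamma> * szego a a = 0" using a2 by (simp add: s2)
  from h2_le_divide_zero[OF a hu this] obtain g where
    "h2_le g K" "\<And>z. z \<in> unit_disc \<Longrightarrow> f z - \<gamma> * szego a z = blaschke a z * g z" by blast
  moreover from this(2) have "\<forall>z\<in>unit_disc. f z = \<gamma> * szego a z + blaschke a z * g z"
    by (simp add: algebra_simps)
  ultimately show ?thesis using K2 by blast
qed

section \<open>Multiplication by powers of 1 - z along a sparse sequence\<close>

text \<open>The previous lemma applied to \<open>f\<close> with the first point, then to the remaining factor with the
  second point, and so on. The remainders \<open>g\<close> keep the expansion exact at each step; this is
  what is evaluated at the points \<open>\<mu> j\<close> later.\<close>

lemma malmquist_expansion:
  fixes \<mu> :: "nat \<Rightarrow> real" and f :: "complex \<Rightarrow> complex"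
  assumes \<mu>: "\<And>j. 0 \<le> \<mu> j" "\<And>j. \<mu> j < 1" and f: "h2_le f M"
  shows "\<exists>\<gamma> g. g 0 = f \<and> (\<forall>n. L2_set (\<lambda>j. cmod (\<gamma> j)) {..<n} \<le> M) \<and>
    (\<forall>j. \<forall>z\<in>unit_disc. g j z = \<gamma> j * szego (\<mu> j) z + blaschke (\<mu> j) z * g (Suc j) z)"
proof -
  define P where "P n x \<longleftrightarrow> h2_le (fst x) (snd x) \<and> (n = 0 \<longrightarrow> x = (f, M))"
    for n :: nat and x :: "(complex \<Rightarrow> complex) \<times> real"
  define Q where "Q n x y \<longleftrightarrow> (\<exists>\<gamma>. (cmod \<gamma>)\<^sup>2 + (snd y)\<^sup>2 \<le> (snd x)\<^sup>2 \<and>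
    (\<forall>z\<in>unit_disc. fst x z = \<gamma> * szego (\<mu> n) z + blaschke (\<mu> n) z * fst y z))"
    for n and x y :: "(complex \<Rightarrow> complex) \<times> real"
  have "P 0 (f, M)" using f by (simp add: P_def)
  moreover have "\<exists>y. P (Suc n) y \<and> Q n x y" if "P n x" for n x
    using szego_decomposition[OF \<mu>[of n], of "fst x" "snd x"] that
    unfolding P_def Q_def by auto
  ultimately obtain G where G: "\<And>n. P n (G n)" "\<And>n. Q n (G n) (G (Suc n))"
    using dependent_nat_choice[of P Q] by metis
  obtain \<gamma> where \<gamma>: "\<And>n. (cmod (\<gamma> n))\<^sup>2 + (snd (G (Suc n)))\<^sup>2 \<le> (snd (G n))\<^sup>2"
    "\<And>n z. z \<in> unit_disc \<Longrightarrow>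
      fst (G n) z = \<gamma> n * szego (\<mu> n) z + blaschke (\<mu> n) z * fst (G (Suc n)) z"
    using that choice[of "\<lambda>n \<gamma>. (cmod \<gamma>)\<^sup>2 + (snd (G (Suc n)))\<^sup>2 \<le> (snd (G n))\<^sup>2 \<and>
      (\<forall>z\<in>unit_disc. fst (G n) z = \<gamma> * szego (\<mu> n) z + blaschke (\<mu> n) z * fst (G (Suc n)) z)"]
      G(2) unfolding Q_def by fast
  have G0: "G 0 = (f, M)" using G(1)[of 0] by (simp add: P_def)
  have sum: "(\<Sum>j<n. (cmod (\<gamma> j))\<^sup>2) + (snd (G n))\<^sup>2 \<le> M\<^sup>2" for n
  proof (induction n)
    case (Suc n)
    then show ?case using \<gamma>(1)[of n] by simp
  qed (simp add: G0)
  have "L2_set (\<lambda>j. cmod (\<gamma> j)) {..<n} \<le> M" for n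
  proof -
    have "(\<Sum>j<n. (cmod (\<gamma> j))\<^sup>2) \<le> M\<^sup>2" using sum[of n] zero_le_power2[of "snd (G n)"] by linarith
    then show ?thesis unfolding L2_set_def using h2_le_nonneg[OF f] by (intro real_le_lsqrt) (auto intro: sum_nonneg)
  qed
  then show ?thesis
    by (intro exI[of _ \<gamma>] exI[of _ "\<lambda>n. fst (G n)"] conjI allI ballI \<gamma>(2)) (simp_all add: G0)
qed

lemma h2_le_blaschke_prod:
  fixes \<mu> :: "nat \<Rightarrow> real" and f :: "complex \<Rightarrow> complex"
  assumes "\<And>j. 0 \<le> \<mu> j" "\<And>j. \<mu> j < 1" "h2_le f M"
  shows "h2_le (\<lambda>z. (\<Prod>i<n. blaschke (\<mu> i) z) * f z) M"
proof (induction n)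
  case (Suc n)
  from h2_le_blaschke[OF assms(1,2)[of n] this] show ?case by (simp add: mult_ac)
qed (simp add: assms)

text \<open>Multiplication by \<open>1 - z\<close>, modulo functions that vanish at all \<open>\<mu> j\<close>, is a small operator if the
  points are close to 1 in the summed sense. This is a Hilbert space form of Newman's inequality
  for Muentz polynomials: in terms of Taylor coefficients, the orthogonal complement of these functions
  is spanned by the sequences \<open>\<mu>\<^sub>j\<^sup>n\<close>, and the adjoint operator takes the differences of successive terms.\<close>

lemma multiply_one_minus:
  fixes \<mu> :: "nat \<Rightarrow> real" and f :: "complex \<Rightarrow> complex"
  assumes \<mu>: "\<And>j. 0 \<le> \<mu> j" "\<And>j. \<mu> j < 1" and sm: "summable (\<lambda>j. 1 - \<mu> j)"
    and eps: "0 \<le> \<epsilon>" "8 * (\<Sum>j. 1 - \<mu> j) \<le> \<epsilon>\<^sup>2" and f: "h2_le f M"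
  shows "\<exists>h :: complex \<Rightarrow> complex. h2_le h (\<epsilon> * M) \<and> (\<forall>j. h (\<mu> j) = complex_of_real (1 - \<mu> j) * f (\<mu> j))"
proof -
  obtain \<gamma> g where g0: "g 0 = f" and \<gamma>: "\<And>n. L2_set (\<lambda>j. cmod (\<gamma> j)) {..<n} \<le> M"
    and g: "\<And>j z. z \<in> unit_disc \<Longrightarrow>
      g j z = \<gamma> j * szego (\<mu> j) z + blaschke (\<mu> j) z * g (Suc j) z"
  proof -
    from malmquist_expansion[where \<mu> = \<mu>, OF \<mu> f] obtain \<gamma> g where *: "g 0 = f"
      "\<forall>n. L2_set (\<lambda>j. cmod (\<gamma> j)) {..<n} \<le> M"
      "\<forall>j. \<forall>z\<in>unit_disc. g j z = \<gamma> j * szego (\<mu> j) z + blaschke (\<mu> j) z * g (Suc j) z"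
      by (elim exE conjE)
    show ?thesis by (rule that[of g \<gamma>, OF *(1) *(2)[rule_format] *(3)[rule_format]])
  qed
  define s where "s j = sqrt (1 - (\<mu> j)\<^sup>2)" for j
  define t where "t j z = \<gamma> j * (complex_of_real (1 - \<mu> j) * szego (\<mu> j) z - complex_of_real (s j) * blaschke (\<mu> j) z)" for j z
  define B where "B n z = (\<Prod>i<n. blaschke (\<mu> i) z)" for n z
  have sq: "(1 - \<mu> j)\<^sup>2 \<le> 1 - (\<mu> j)\<^sup>2" "1 - (\<mu> j)\<^sup>2 \<le> 2 * (1 - \<mu> j)" "0 \<le> 1 - (\<mu> j)\<^sup>2" for j
  proof -
    have "0 \<le> 2 * (\<mu> j * (1 - \<mu> j))" using \<mu>[of j] by simp
    then show "(1 - \<mu> j)\<^sup>2 \<le> 1 - (\<mu> j)\<^sup>2" by (simp add: power2_eq_square algebra_simps)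
    then show "0 \<le> 1 - (\<mu> j)\<^sup>2" by (meson order_trans zero_le_power2)
    have "0 \<le> (1 - \<mu> j)\<^sup>2" by simp
    then show "1 - (\<mu> j)\<^sup>2 \<le> 2 * (1 - \<mu> j)" by (simp add: power2_eq_square algebra_simps)
  qed
  have s: "1 - \<mu> j \<le> s j" "0 \<le> s j" "(s j)\<^sup>2 \<le> 2 * (1 - \<mu> j)" for j
    using sq[of j] by (auto simp: s_def intro: real_le_rsqrt)
  have t: "h2_le (t j) (2 * (s j * cmod (\<gamma> j)))" for j
  proof -
    have "h2_le (\<lambda>z. complex_of_real (1 - \<mu> j) * szego (\<mu> j) z) (cmod (complex_of_real (1 - \<mu> j)) * 1)"
      by (intro h2_le_cmult h2_le_szego \<mu>)
    moreover have "h2_le (\<lambda>z. - complex_of_real (s j) * (blaschke (\<mu> j) z * 1)) (cmod (- complex_of_real (s j)) * 1)"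
      by (intro h2_le_cmult h2_le_blaschke h2_le_one \<mu>)
    ultimately have "h2_le (\<lambda>z. \<gamma> j * (complex_of_real (1 - \<mu> j) * szego (\<mu> j) z + - complex_of_real (s j) * (blaschke (\<mu> j) z * 1)))
      (cmod (\<gamma> j) * (cmod (complex_of_real (1 - \<mu> j)) * 1 + cmod (- complex_of_real (s j)) * 1))"
      by (rule h2_le_cmult[OF h2_le_add])
    then have "h2_le (t j) (cmod (\<gamma> j) * (cmod (complex_of_real (1 - \<mu> j)) * 1 + cmod (- complex_of_real (s j)) * 1))"
      by (rule h2_le_cong) (simp add: t_def)
    moreover have "cmod (complex_of_real (1 - \<mu> j)) + cmod (- complex_of_real (s j)) \<le> 2 * s j"
      using s[of j] \<mu>[of j] by (simp add: norm_minus_cancel del: of_real_diff)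
    then have "cmod (\<gamma> j) * (cmod (complex_of_real (1 - \<mu> j)) * 1 + cmod (- complex_of_real (s j)) * 1) \<le> cmod (\<gamma> j) * (2 * s j)"
      by (intro mult_left_mono) auto
    ultimately have "h2_le (t j) (cmod (\<gamma> j) * (2 * s j))" by (rule h2_le_mono)
    then show ?thesis by (simp add: mult_ac)
  qed
  have Bt: "h2_le (\<lambda>z. B j z * t j z) (2 * (s j * cmod (\<gamma> j)))" for j
    unfolding B_def by (rule h2_le_blaschke_prod[OF \<mu> t])
  have part: "(\<Sum>j<n. 2 * (s j * cmod (\<gamma> j))) \<le> \<epsilon> * M" for n
  proof -
    have "(\<Sum>j<n. s j * cmod (\<gamma> j)) \<le> L2_set s {..<n} * L2_set (\<lambda>j. cmod (\<gamma> j)) {..<n}"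
      using L2_set_mult_ineq[of s "\<lambda>j. cmod (\<gamma> j)" "{..<n}"] s by simp
    also have "\<dots> \<le> (\<epsilon> / 2) * M"
    proof (rule mult_mono)
      have "(\<Sum>j<n. (s j)\<^sup>2) \<le> (\<Sum>j<n. 2 * (1 - \<mu> j))" by (rule sum_mono) (use s in auto)
      also have "\<dots> = 2 * (\<Sum>j<n. 1 - \<mu> j)" by (simp add: sum_distrib_left)
      also have "(\<Sum>j<n. 1 - \<mu> j) \<le> (\<Sum>j. 1 - \<mu> j)"
        using \<mu>(2) by (intro sum_le_suminf sm) (auto intro: less_imp_le)
      finally have "(\<Sum>j<n. (s j)\<^sup>2) \<le> (\<epsilon> / 2)\<^sup>2"
        using eps by (simp add: power_divide)
      then show "L2_set s {..<n} \<le> \<epsilon> / 2" unfolding L2_set_def using eps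
        by (intro real_le_lsqrt) (auto intro: sum_nonneg)
    qed (use eps \<gamma> in \<open>auto simp: L2_set_nonneg\<close>)
    finally show ?thesis by (simp add: sum_distrib_left[symmetric])
  qed
  have sN: "summable (\<lambda>j. 2 * (s j * cmod (\<gamma> j)))"
    by (rule summableI_nonneg_bounded[where x = "\<epsilon> * M"]) (use s part in auto)
  obtain h where h: "h2_le h (\<Sum>j. 2 * (s j * cmod (\<gamma> j)))"
    "\<And>z. z \<in> unit_disc \<Longrightarrow> (\<lambda>j. B j z * t j z) sums h z"
    using h2_le_series[OF Bt sN] by blast
  have "h2_le h (\<epsilon> * M)" by (rule h2_le_mono[OF h(1) suminf_le_const[OF sN part]])
  moreover have "h (\<mu> m) = complex_of_real (1 - \<mu> m) * f (\<mu> m)" for m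
  proof -
    define z where "z = complex_of_real (\<mu> m)"
    have z: "z \<in> unit_disc" using \<mu>[of m] by (simp add: z_def)
    \<comment> \<open>Iterating this writes \<open>(1 - z) f\<close> as a partial sum of \<open>h\<close> plus a multiple of the Blaschke
      product of the first \<open>n\<close> points, which vanishes at these points.\<close>
    have step: "(1 - z) * g j z = t j z + blaschke (\<mu> j) z * ((1 - z) * g (Suc j) z)" for j
    proof -
      have "1 - of_real (\<mu> j) * z \<noteq> 0" using one_minus_mult_nonzero[OF \<mu>] z by simp
      then have "(1 - z) * szego (\<mu> j) z = complex_of_real (1 - \<mu> j) * szego (\<mu> j) z - complex_of_real (s j) * blaschke (\<mu> j) z"
        by (simp add: szego_def blaschke_def s_def divide_simps) (simp add: algebra_simps)
      then show ?thesis unfolding t_def g[OF z, of j] by (simp add: algebra_simps)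
    qed
    have tele: "(1 - z) * f z = (\<Sum>j<n. B j z * t j z) + B n z * ((1 - z) * g n z)" for n
    proof (induction n)
      case (Suc n)
      have "B (Suc n) z = B n z * blaschke (\<mu> n) z" by (simp add: B_def mult.commute)
      with Suc show ?case by (simp only: step[of n]) (simp add: distrib_left mult.assoc)
    qed (simp add: B_def g0)
    have Bz: "B n z = 0" if "n > m" for n
      unfolding B_def using that by (intro prod_zero) (auto intro!: bexI[of _ m] simp: blaschke_def z_def)
    have "(\<lambda>j. B j z * t j z) sums (\<Sum>j<Suc m. B j z * t j z)"
      by (rule sums_finite) (use Bz in auto)
    then have "h z = (\<Sum>j<Suc m. B j z * t j z)" using h(2)[OF z] sums_unique2 by blast
    also have "\<dots> = (1 - z) * f z" using tele[of "Suc m"] Bz[of "Suc m"] by simp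
    finally show ?thesis by (simp add: z_def)
  qed
  ultimately show ?thesis by blast
qed

lemma multiply_one_minus_power:
  fixes \<mu> :: "nat \<Rightarrow> real" and f :: "complex \<Rightarrow> complex"
  assumes \<mu>: "\<And>j. 0 \<le> \<mu> j" "\<And>j. \<mu> j < 1" and sm: "summable (\<lambda>j. 1 - \<mu> j)"
    and eps: "0 \<le> \<epsilon>" "8 * (\<Sum>j. 1 - \<mu> j) \<le> \<epsilon>\<^sup>2" and f: "h2_le f M"
  shows "\<exists>h :: complex \<Rightarrow> complex. h2_le h (\<epsilon> ^ k * M) \<and> (\<forall>j. h (\<mu> j) = complex_of_real (1 - \<mu> j) ^ k * f (\<mu> j))"
proof (induction k)
  case 0
  show ?case using f by auto
next
  case (Suc k)
  then obtain h where h: "h2_le h (\<epsilon> ^ k * M)" "\<And>j. h (\<mu> j) = complex_of_real (1 - \<mu> j) ^ k * f (\<mu> j)" by blast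
  show ?case using multiply_one_minus[OF \<mu> sm eps h(1)] h(2) by (auto simp: mult_ac)
qed

text \<open>This turns analytic functions of \<open>1 - z\<close> near 0 into multipliers, as far as values at the \<open>\<mu> j\<close> are
  concerned: they need not extend to the disc.\<close>

lemma interpolate_power_series:
  fixes \<mu> :: "nat \<Rightarrow> real" and F :: "nat \<Rightarrow> complex \<Rightarrow> complex"
  assumes \<mu>: "\<And>j. 0 \<le> \<mu> j" "\<And>j. \<mu> j < 1" and sm: "summable (\<lambda>j. 1 - \<mu> j)"
    and eps: "0 \<le> \<epsilon>" "8 * (\<Sum>j. 1 - \<mu> j) \<le> \<epsilon>\<^sup>2"
    and F: "\<And>k. h2_le (F k) (C k)" and C: "summable (\<lambda>k. \<epsilon> ^ k * C k)"
  shows "\<exists>(\<psi> :: complex \<Rightarrow> complex) M. h2_le \<psi> M \<and> (\<forall>j. (\<lambda>k. complex_of_real (1 - \<mu> j) ^ k * F k (\<mu> j)) sums \<psi> (\<mu> j))"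
proof -
  obtain h where h: "\<And>k. h2_le (h k) (\<epsilon> ^ k * C k)"
    "\<And>k j. h k (\<mu> j) = complex_of_real (1 - \<mu> j) ^ k * F k (\<mu> j)"
  proof -
    have "\<forall>k. \<exists>h. h2_le h (\<epsilon> ^ k * C k) \<and>
        (\<forall>j. h (of_real (\<mu> j)) = complex_of_real (1 - \<mu> j) ^ k * F k (of_real (\<mu> j)))"
      using multiply_one_minus_power[where \<mu> = \<mu>, OF \<mu> sm eps F] by blast
    then obtain h where "\<forall>k. h2_le (h k) (\<epsilon> ^ k * C k) \<and>
        (\<forall>j. h k (of_real (\<mu> j)) = complex_of_real (1 - \<mu> j) ^ k * F k (of_real (\<mu> j)))"
      by (rule choice[THEN exE])
    with that[of h] show ?thesis by blast
  qed
  obtain \<psi> where \<psi>: "h2_le \<psi> (\<Sum>k. \<epsilon> ^ k * C k)"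
    "\<And>z. z \<in> unit_disc \<Longrightarrow> (\<lambda>k. h k z) sums \<psi> z"
    using h2_le_series[OF h(1) C] by blast
  have "(\<lambda>k. complex_of_real (1 - \<mu> j) ^ k * F k (\<mu> j)) sums \<psi> (\<mu> j)" for j
    using \<psi>(2)[of "of_real (\<mu> j)"] \<mu>[of j] h(2) by simp
  with \<psi>(1) show ?thesis by blast
qed

text \<open>Take \<open>f = 1\<close> in \<open>multiply_one_minus\<close>, for a tail. If the tail starts far enough out, the resulting
  function is so small at \<open>\<mu> h\<close> that it differs from \<open>1 - z\<close> there, while the two
  agree on the tail. The zeros at the remaining points are supplied by linear factors.\<close>

lemma separating_function:
  fixes \<mu> :: "nat \<Rightarrow> real"
  assumes \<mu>: "\<And>j. 0 \<le> \<mu> j" "\<And>j. \<mu> j < 1" and sm: "summable (\<lambda>j. 1 - \<mu> j)" and inj: "inj \<mu>"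
  shows "\<exists>(g :: complex \<Rightarrow> complex) M. h2_le g M \<and> g (\<mu> h) = 1 \<and> (\<forall>j. j \<noteq> h \<longrightarrow> g (\<mu> j) = 0)"
proof -
  \<comment> \<open>A function of norm \<open>\<epsilon>\<close> is at most \<open>\<epsilon> / (1 - \<mu> h)\<close> at \<open>\<mu> h\<close>, which has to be less than \<open>1 - \<mu> h\<close>.\<close>
  define \<epsilon> where "\<epsilon> = (1 - \<mu> h)\<^sup>2 / 2"
  have eps: "0 < \<epsilon>" using \<mu>[of h] by (simp add: \<epsilon>_def)
  have "(\<lambda>n. \<Sum>j. 1 - \<mu> (j + n)) \<longlonglongrightarrow> 0" by (rule suminf_exist_split2[OF sm])
  from LIMSEQ_D[OF this, of "\<epsilon>\<^sup>2 / 8"] eps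
  obtain n0 where n0: "\<And>n. n \<ge> n0 \<Longrightarrow> norm ((\<Sum>j. 1 - \<mu> (j + n)) - 0) < \<epsilon>\<^sup>2 / 8"
    by auto
  define n where "n = max n0 (Suc h)"
  have n: "n0 \<le> n" "h < n" by (auto simp: n_def)
  have "8 * (\<Sum>j. 1 - \<mu> (j + n)) \<le> \<epsilon>\<^sup>2" using n0[OF n(1)] by simp
  from multiply_one_minus[where \<mu> = "\<lambda>j. \<mu> (j + n)" and \<epsilon> = \<epsilon>,
      OF \<mu> summable_ignore_initial_segment[OF sm] less_imp_le[OF eps] this h2_le_one]
  obtain A where A: "h2_le A (\<epsilon> * 1)" "\<And>j. A (\<mu> (j + n)) = complex_of_real (1 - \<mu> (j + n)) * 1"
    by (elim exE conjE) blast
  define g0 where "g0 z = (z - 1) * 1 + A z" for z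
  have g0: "h2_le g0 (1 + cmod 1 * 1 + \<epsilon> * 1)"
    unfolding g0_def by (intro h2_le_add h2_le_linear_factor h2_le_one A)
  have g0_zero: "g0 (\<mu> j) = 0" if "j \<ge> n" for j
    using A(2)[of "j - n"] that by (simp add: g0_def)
  have "cmod (A (\<mu> h)) \<le> \<epsilon> / (1 - \<mu> h)"
    using h2_le_eval[OF A(1), of "of_real (\<mu> h)"] \<mu>[of h] by simp
  also have "\<dots> < 1 - \<mu> h" using \<mu>[of h] by (simp add: \<epsilon>_def divide_simps power2_eq_square)
  finally have "cmod (A (\<mu> h)) < 1 - \<mu> h" .
  moreover have "cmod (complex_of_real (1 - \<mu> h)) = 1 - \<mu> h"
    using \<mu>[of h] by (simp only: norm_of_real)
  ultimately have "A (\<mu> h) \<noteq> complex_of_real (1 - \<mu> h)" by (metis less_irrefl)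
  then have g0_h: "g0 (\<mu> h) \<noteq> 0"
    unfolding g0_def by (simp add: eq_iff_diff_eq_0[of "A (\<mu> h)"] algebra_simps)
  define q where "q S z = (\<Prod>i\<in>S. z - complex_of_real (\<mu> i))" for S z
  have "\<exists>M. h2_le (\<lambda>z. q S z * g0 z) M" if "finite S" for S
    using that
  proof induction
    case empty
    show ?case using g0 by (auto simp: q_def)
  next
    case (insert i S)
    then obtain M where "h2_le (\<lambda>z. q S z * g0 z) M" by blast
    from h2_le_linear_factor[OF this, of "of_real (\<mu> i)"] insert show ?case by (auto simp: q_def mult_ac)
  qed
  then obtain M where M: "h2_le (\<lambda>z. q ({..<n} - {h}) z * g0 z) M" by blast
  define w where "w = q ({..<n} - {h}) (\<mu> h) * g0 (\<mu> h)"
  have "w \<noteq> 0" using g0_h inj by (auto simp: w_def q_def inj_def)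
  moreover have "q ({..<n} - {h}) (\<mu> j) * g0 (\<mu> j) = 0" if "j \<noteq> h" for j
    using g0_zero[of j] that by (cases "j < n") (auto simp: q_def intro!: prod_zero bexI[of _ j])
  ultimately show ?thesis
    using h2_le_cmult[OF M, of "1 / w"]
    by (intro exI[of _ "\<lambda>z. 1 / w * (q ({..<n} - {h}) z * g0 z)"] exI[of _ "cmod (1/w) * M"])
       (auto simp: w_def)
qed

section \<open>Composition with a real power\<close>

lemma double_series_swap:
  fixes a :: "nat \<Rightarrow> nat \<Rightarrow> complex" and A B :: "nat \<Rightarrow> real"
  assumes le: "\<And>i k. cmod (a i k) \<le> A i * B k" and sA: "summable A" and sB: "summable B"
    and nonneg: "\<And>i. 0 \<le> A i" "\<And>k. 0 \<le> B k"
    and b: "\<And>i. (\<lambda>k. a i k) sums b i" and d: "\<And>k. (\<lambda>i. a i k) sums d k" and s: "d sums s"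
  shows "b sums s"
proof -
  have hA: "(A has_sum suminf A) UNIV" and hB: "(B has_sum suminf B) UNIV"
    using nonneg sA sB by (auto intro!: sums_nonneg_imp_has_sum summable_sums)
  have "(\<lambda>(i, k). A i * B k) summable_on UNIV \<times> UNIV"
  proof (rule summable_on_SigmaI)
    show "((\<lambda>k. case (i, k) of (i, k) \<Rightarrow> A i * B k) has_sum A i * suminf B) UNIV" for i
      using has_sum_cmult_right[OF hB, of "A i"] by simp
    show "(\<lambda>i. A i * suminf B) summable_on UNIV"
      using has_sum_cmult_left[OF hA, of "suminf B"] by (rule has_sum_imp_summable)
  qed (use nonneg in auto)
  then have "(\<lambda>x. norm ((\<lambda>(i, k). a i k) x)) summable_on UNIV \<times> UNIV"
    by (rule Infinite_Sum.abs_summable_on_comparison_test') (use le in auto)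
  then have sm: "(\<lambda>(i, k). a i k) summable_on UNIV \<times> UNIV"
    by (rule abs_summable_summable)
  then obtain S where S: "((\<lambda>(i, k). a i k) has_sum S) (UNIV \<times> UNIV)"
    by (auto simp: summable_on_def)
  have row: "((\<lambda>k. a i k) has_sum b i) UNIV" for i
    using summable_on_SigmaD1[OF sm, of i] b[of i] has_sum_imp_sums sums_unique2
    by (metis UNIV_I summable_on_def)
  have S': "((\<lambda>(k, i). a i k) has_sum S) (UNIV \<times> UNIV)"
    using S has_sum_swap[where f = "\<lambda>(i, k). a i k" and S = S and A = UNIV and B = UNIV] by (simp add: case_prod_unfold)
  have col: "((\<lambda>i. a i k) has_sum d k) UNIV" for k
    using summable_on_SigmaD1[OF has_sum_imp_summable[OF S'], of k] d[of k] has_sum_imp_sums sums_unique2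
    by (metis UNIV_I summable_on_def)
  have "(b has_sum S) UNIV" using has_sum_SigmaD[OF S, of b] row by simp
  moreover have "(d has_sum S) UNIV" using has_sum_SigmaD[OF S', of d] col by simp
  ultimately show ?thesis using s has_sum_imp_sums sums_unique2 by metis
qed

lemma abs_gbinomial_le_one:
  fixes t :: real
  assumes "0 \<le> t" "t \<le> 1"
  shows "\<bar>t gchoose k\<bar> \<le> 1"
proof -
  have "\<bar>\<Prod>i = 0..<k. t - of_nat i\<bar> = (\<Prod>i = 0..<k. \<bar>t - of_nat i\<bar>)" by (rule abs_prod)
  also have "\<dots> \<le> (\<Prod>i = 0..<k. of_nat (Suc i))"
    using assms by (intro prod_mono) (auto simp: abs_le_iff)
  also have "\<dots> = fact k" by (simp add: fact_prod_Suc)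
  finally have "\<bar>fact k * (t gchoose k)\<bar> \<le> fact k" by (simp only: gbinomial_mult_fact)
  then show ?thesis by (simp add: abs_mult)
qed

lemma l2_le_subseq:
  assumes "strict_mono g" "l2_le c M" shows "l2_le (\<lambda>i. c (g i)) M"
proof (rule l2_leI[OF l2_le_nonneg[OF assms(2)]])
  fix N
  have "(\<Sum>i<N. (cmod (c (g i)))\<^sup>2) = (\<Sum>n\<in>g ` {..<N}. (cmod (c n))\<^sup>2)"
    using assms(1) by (subst sum.reindex) (auto simp: strict_mono_imp_inj_on inj_on_subset)
  also have "\<dots> \<le> (\<Sum>n<g N. (cmod (c n))\<^sup>2)"
    using assms(1) by (intro sum_mono2) (auto simp: strict_mono_less)
  also have "\<dots> \<le> M\<^sup>2" by (rule l2_le_partial[OF assms(2)])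
  finally show "(\<Sum>i<N. (cmod (c (g i)))\<^sup>2) \<le> M\<^sup>2" .
qed

lemma h2_le_spread:
  assumes g: "strict_mono (g :: nat \<Rightarrow> nat)" and c: "l2_le c M"
  shows "\<exists>f. h2_le f M \<and> (\<forall>z\<in>unit_disc. (\<lambda>i. c i * z ^ g i) sums f z)"
proof -
  have inj: "inj g" using g by (rule strict_mono_imp_inj_on)
  define C where "C n = (if n \<in> range g then c (inv g n) else 0)" for n
  have Cg: "C (g i) = c i" for i using inj by (simp add: C_def)
  have "l2_le C M"
  proof (rule l2_leI[OF l2_le_nonneg[OF c]])
    fix N
    have "(\<Sum>n<N. (cmod (C n))\<^sup>2) = (\<Sum>n\<in>{..<N} \<inter> range g. (cmod (C n))\<^sup>2)"
      by (rule sum.mono_neutral_right) (auto simp: C_def)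
    also have "\<dots> \<le> (\<Sum>n\<in>g ` {..<N}. (cmod (C n))\<^sup>2)"
    proof (rule sum_mono2)
      show "{..<N} \<inter> range g \<subseteq> g ` {..<N}"
      proof
        fix n assume "n \<in> {..<N} \<inter> range g"
        then obtain i where i: "g i < N" "n = g i" by auto
        with strict_mono_imp_increasing[OF g, of i] have "i < N" by linarith
        with i show "n \<in> g ` {..<N}" by auto
      qed
    qed auto
    also have "\<dots> = (\<Sum>i<N. (cmod (c i))\<^sup>2)"
      using inj by (subst sum.reindex) (auto simp: Cg intro: inj_on_subset)
    also have "\<dots> \<le> M\<^sup>2" by (rule l2_le_partial[OF c])
    finally show "(\<Sum>n<N. (cmod (C n))\<^sup>2) \<le> M\<^sup>2" .
  qed
  moreover from this have "taylor (\<lambda>z. \<Sum>n. C n * z ^ n) C" using taylor_suminf l2_le_coeff by blast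
  moreover from this have "\<forall>z\<in>unit_disc. (\<lambda>i. c i * z ^ g i) sums (\<Sum>n. C n * z ^ n)"
    using sums_mono_reindex[OF g, of "\<lambda>n. C n * _ ^ n"] unfolding taylor_def by (auto simp: C_def inj)
  ultimately show ?thesis unfolding h2_le_def by blast
qed

text \<open>Gaps of length at least 1 make the integral parts of the exponents distinct, so replacing the
  exponents by them yields a power series with the same coefficients. The fractional parts
  are then put back by the binomial series in \<open>1 - \<mu> j\<close>.\<close>

lemma interpolate_real_powers:
  fixes \<mu> e :: "nat \<Rightarrow> real" and c :: "nat \<Rightarrow> complex"
  assumes \<mu>: "\<And>j. 0 < \<mu> j" "\<And>j. \<mu> j < 1" and sm: "summable (\<lambda>j. 1 - \<mu> j)"
    and eps: "0 \<le> \<epsilon>" "\<epsilon> < 1" "8 * (\<Sum>j. 1 - \<mu> j) \<le> \<epsilon>\<^sup>2"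
    and c: "l2_le c M" and e: "\<And>i. 0 \<le> e i" "\<And>i. e i + 1 \<le> e (Suc i)"
  shows "\<exists>(\<psi> :: complex \<Rightarrow> complex) M'. h2_le \<psi> M' \<and>
    (\<forall>j. (\<lambda>i. c i * complex_of_real (\<mu> j powr e i)) sums \<psi> (\<mu> j))"
proof -
  define g where "g i = nat \<lfloor>e i\<rfloor>" for i
  define \<tau> where "\<tau> i = e i - real (g i)" for i
  have \<tau>: "0 \<le> \<tau> i" "\<tau> i \<le> 1" for i using e(1)[of i] unfolding \<tau>_def g_def by linarith+
  have g: "strict_mono g"
    unfolding strict_mono_Suc_iff g_def
  proof
    fix i
    have "\<lfloor>e i + 1\<rfloor> \<le> \<lfloor>e (Suc i)\<rfloor>" by (rule floor_mono[OF e(2)])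
    moreover have "0 \<le> \<lfloor>e i\<rfloor>" using e(1)[of i] by simp
    ultimately have "0 \<le> \<lfloor>e i\<rfloor>" "\<lfloor>e i\<rfloor> < \<lfloor>e (Suc i)\<rfloor>" by simp_all
    then show "nat \<lfloor>e i\<rfloor> < nat \<lfloor>e (Suc i)\<rfloor>" by (subst nat_less_eq_zless)
  qed
  define w where "w k i = (-1) ^ k * complex_of_real (\<tau> i gchoose k)" for k i
  have w: "cmod (w k i) \<le> 1" for k i
    using abs_gbinomial_le_one[OF \<tau>] by (simp add: w_def norm_mult norm_power)
  have wc: "cmod (w k i * c i) \<le> cmod (c i)" for k i
    using mult_right_mono[OF w[of k i], of "cmod (c i)"] by (simp add: norm_mult)
  have "l2_le (\<lambda>i. w k i * c i) M" for k
  proof (rule l2_leI[OF l2_le_nonneg[OF c]])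
    fix N
    have "(\<Sum>i<N. (cmod (w k i * c i))\<^sup>2) \<le> (\<Sum>i<N. (cmod (c i))\<^sup>2)"
      by (intro sum_mono power_mono wc) auto
    also have "\<dots> \<le> M\<^sup>2" by (rule l2_le_partial[OF c])
    finally show "(\<Sum>i<N. (cmod (w k i * c i))\<^sup>2) \<le> M\<^sup>2" .
  qed
  then have "\<forall>k. \<exists>f. h2_le f M \<and> (\<forall>z\<in>unit_disc. (\<lambda>i. w k i * c i * z ^ g i) sums f z)"
    using h2_le_spread[OF g] by blast
  then obtain F where F: "\<forall>k. h2_le (F k) M \<and> (\<forall>z\<in>unit_disc. (\<lambda>i. w k i * c i * z ^ g i) sums F k z)"
    by (rule choice[THEN exE])
  have "summable (\<lambda>k. \<epsilon> ^ k * M)" using eps by (intro summable_mult2 summable_geometric) auto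
  with interpolate_power_series[where \<mu> = \<mu> and F = F and C = "\<lambda>_. M", OF less_imp_le[OF \<mu>(1)] \<mu>(2) sm eps(1,3)] F
  obtain \<psi> M' where \<psi>: "h2_le \<psi> M'"
    "\<And>j. (\<lambda>k. complex_of_real (1 - \<mu> j) ^ k * F k (\<mu> j)) sums \<psi> (\<mu> j)"
    by blast
  have "(\<lambda>i. c i * complex_of_real (\<mu> j powr e i)) sums \<psi> (\<mu> j)" for j
  proof (rule double_series_swap[where A = "\<lambda>i. M * \<mu> j ^ i" and B = "\<lambda>k. (1 - \<mu> j) ^ k"])
    define a where "a i k = complex_of_real (1 - \<mu> j) ^ k * (w k i * c i * complex_of_real (\<mu> j) ^ g i)" for i k
    have M: "0 \<le> M" by (rule l2_le_nonneg[OF c])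
    show "cmod (a i k) \<le> M * \<mu> j ^ i * (1 - \<mu> j) ^ k" for i k
    proof -
      have "cmod (w k i * c i) \<le> M" using wc l2_le_coeff[OF c] by (rule order_trans)
      moreover have "\<mu> j ^ g i \<le> \<mu> j ^ i"
        using \<mu>[of j] strict_mono_imp_increasing[OF g, of i] by (intro power_decreasing) auto
      ultimately have "cmod (w k i * c i) * \<mu> j ^ g i \<le> M * \<mu> j ^ i"
        using \<mu>(1)[of j] M by (intro mult_mono) auto
      then have "(1 - \<mu> j) ^ k * (cmod (w k i * c i) * \<mu> j ^ g i) \<le> (1 - \<mu> j) ^ k * (M * \<mu> j ^ i)"
        using \<mu>(2)[of j] by (intro mult_left_mono) auto
      moreover have "cmod (a i k) = (1 - \<mu> j) ^ k * (cmod (w k i * c i) * \<mu> j ^ g i)"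
        unfolding a_def norm_mult norm_power norm_of_real using \<mu>[of j] by simp
      ultimately show ?thesis by (simp add: mult_ac)
    qed
    show "summable (\<lambda>i. M * \<mu> j ^ i)" "summable (\<lambda>k. (1 - \<mu> j) ^ k)"
      using \<mu>[of j] by (auto intro!: summable_mult summable_geometric)
    show "0 \<le> M * \<mu> j ^ i" "0 \<le> (1 - \<mu> j) ^ i" for i using M \<mu>[of j] by auto
    show "a i sums (c i * complex_of_real (\<mu> j powr e i))" for i
    proof -
      have "(\<lambda>k. (\<tau> i gchoose k) * (\<mu> j - 1) ^ k) sums (1 + (\<mu> j - 1)) powr \<tau> i"
        using \<mu>[of j] by (intro gen_binomial_real) auto
      then have "(\<lambda>k. c i * complex_of_real (\<mu> j) ^ g i * complex_of_real ((\<tau> i gchoose k) * (\<mu> j - 1) ^ k)) sums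
          (c i * complex_of_real (\<mu> j) ^ g i * complex_of_real ((1 + (\<mu> j - 1)) powr \<tau> i))"
        by (intro sums_mult sums_of_real)
      moreover have "c i * complex_of_real (\<mu> j) ^ g i * complex_of_real ((\<tau> i gchoose k) * (\<mu> j - 1) ^ k) = a i k" for k
      proof -
        have "(\<mu> j - 1) ^ k = (-1) ^ k * (1 - \<mu> j) ^ k" by (metis minus_diff_eq mult_minus1 power_mult_distrib)
        then show ?thesis by (simp add: a_def w_def mult_ac)
      qed
      moreover have "\<mu> j powr e i = \<mu> j ^ g i * \<mu> j powr \<tau> i"
        using \<mu>(1)[of j] by (simp add: \<tau>_def flip: powr_realpow powr_add)
      ultimately show ?thesis by (simp add: mult.assoc)
    qed
    show "(\<lambda>i. a i k) sums (complex_of_real (1 - \<mu> j) ^ k * F k (\<mu> j))" for k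
      unfolding a_def using F \<mu>[of j] by (intro sums_mult) auto
    show "(\<lambda>k. complex_of_real (1 - \<mu> j) ^ k * F k (\<mu> j)) sums \<psi> (\<mu> j)" by (rule \<psi>(2))
  qed
  with \<psi>(1) show ?thesis by blast
qed

text \<open>The exponents \<open>q n\<close> have gaps of length \<open>q\<close>, which may be less than 1. Taking \<open>n\<close> in one residue class
  modulo \<open>K\<close> at a time, with \<open>q K \<ge> 1\<close>, makes the gaps long enough.\<close>

lemma interpolate_composition:
  fixes \<mu> :: "nat \<Rightarrow> real" and f :: "complex \<Rightarrow> complex"
  assumes \<mu>: "\<And>j. 0 < \<mu> j" "\<And>j. \<mu> j < 1" and sm: "summable (\<lambda>j. 1 - \<mu> j)"
    and eps: "0 \<le> \<epsilon>" "\<epsilon> < 1" "8 * (\<Sum>j. 1 - \<mu> j) \<le> \<epsilon>\<^sup>2"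
    and f: "h2_le f M" and q: "0 < q"
  shows "\<exists>(\<psi> :: complex \<Rightarrow> complex) M'. h2_le \<psi> M' \<and> (\<forall>j. \<psi> (\<mu> j) = f (complex_of_real (\<mu> j powr q)))"
proof -
  obtain c where c: "taylor f c" "l2_le c M" using f unfolding h2_le_def by blast
  define K where "K = nat \<lceil>1 / q\<rceil>"
  have "1 / q \<le> real K" unfolding K_def by linarith
  then have K: "1 \<le> q * real K" using q by (simp add: field_simps)
  then have K0: "0 < K" by (cases K) auto
  have ex: "\<exists>(\<psi> :: complex \<Rightarrow> complex) M'. h2_le \<psi> M' \<and>
    (\<forall>j. (\<lambda>i. c (i * K + r) * complex_of_real (\<mu> j powr (q * real (i * K + r)))) sums \<psi> (\<mu> j))" for r
  proof (rule interpolate_real_powers[OF \<mu> sm eps])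
    show "l2_le (\<lambda>i. c (i * K + r)) M"
      by (rule l2_le_subseq[OF _ c(2)]) (use K0 in \<open>auto simp: strict_mono_def\<close>)
    show "0 \<le> q * real (i * K + r)" for i using q by simp
    show "q * real (i * K + r) + 1 \<le> q * real (Suc i * K + r)" for i
      using K by (simp add: algebra_simps)
  qed
  have "\<forall>r. \<exists>x :: (complex \<Rightarrow> complex) \<times> real. h2_le (fst x) (snd x) \<and>
    (\<forall>j. (\<lambda>i. c (i * K + r) * complex_of_real (\<mu> j powr (q * real (i * K + r)))) sums fst x (\<mu> j))"
    unfolding split_paired_Ex fst_conv snd_conv by (intro allI ex)
  then obtain X :: "nat \<Rightarrow> (complex \<Rightarrow> complex) \<times> real" where X: "\<forall>r. h2_le (fst (X r)) (snd (X r)) \<and>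
    (\<forall>j. (\<lambda>i. c (i * K + r) * complex_of_real (\<mu> j powr (q * real (i * K + r)))) sums fst (X r) (\<mu> j))"
    by (rule choice[THEN exE])
  define \<psi> where "\<psi> r = fst (X r)" for r
  define M' where "M' r = snd (X r)" for r
  have \<psi>: "\<And>r. h2_le (\<psi> r) (M' r)"
    "\<And>r j. (\<lambda>i. c (i * K + r) * complex_of_real (\<mu> j powr (q * real (i * K + r)))) sums \<psi> r (\<mu> j)"
    using X unfolding \<psi>_def M'_def by blast+
  have "(\<Sum>r<K. \<psi> r (\<mu> j)) = f (complex_of_real (\<mu> j powr q))" for j
  proof -
    define x where "x = \<mu> j powr q"
    have x: "0 < x" "x < 1" using \<mu>[of j] q powr_less_mono2[of q "\<mu> j" 1] by (auto simp: x_def)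
    then have "(\<lambda>n. c n * complex_of_real x ^ n) sums f x" using c(1) unfolding taylor_def by auto
    from sums_group[OF this K0]
    have "(\<lambda>i. \<Sum>n = i * K..<i * K + K. c n * complex_of_real x ^ n) sums f x" .
    moreover have "(\<Sum>n = i * K..<i * K + K. c n * complex_of_real x ^ n)
      = (\<Sum>r<K. c (i * K + r) * complex_of_real (\<mu> j powr (q * real (i * K + r))))" for i
    proof -
      have "complex_of_real x ^ n = complex_of_real (\<mu> j powr (q * real n))" for n
        using x(1) by (simp add: powr_powr x_def flip: powr_realpow of_real_power)
      then show ?thesis
        using sum.shift_bounds_nat_ivl[of "\<lambda>n. c n * complex_of_real x ^ n" 0 "i * K" K]
        by (simp add: add.commute atLeast0LessThan)
    qed
    ultimately have "(\<lambda>i. \<Sum>r<K. c (i * K + r) * complex_of_real (\<mu> j powr (q * real (i * K + r)))) sums f x" by simp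
    moreover have "(\<lambda>i. \<Sum>r<K. c (i * K + r) * complex_of_real (\<mu> j powr (q * real (i * K + r)))) sums (\<Sum>r<K. \<psi> r (\<mu> j))"
      by (intro sums_sum \<psi>(2))
    ultimately show ?thesis unfolding x_def using sums_unique2 by blast
  qed
  with h2_le_sum[of "{..<K}" \<psi> M', OF \<psi>(1)] show ?thesis by blast
qed

section \<open>The change of weights\<close>

text \<open>As a function of \<open>x\<close>, both \<open>1 - (1 - x)\<^sup>2\<^sup>q\<close> and \<open>1 - (1 - x)\<^sup>2\<close> have a simple zero at 0; the quotient is
  analytic with value \<open>q\<close> there. So it stays in the right half-plane near 0, where the square
  root is analytic.\<close>

lemma weight_power_series:
  assumes q: "0 < q"
  shows "\<exists>(d :: nat \<Rightarrow> complex) r. 0 < r \<and> r < 1 \<and> (\<forall>x::real. 0 < x \<and> x < r \<longrightarrow>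
    (\<lambda>k. d k * of_real x ^ k) sums of_real (sqrt ((1 - (1 - x) powr (2 * q)) / (1 - (1 - x)\<^sup>2))))"
proof -
  define g where "g z = 1 - (1 - z) powr complex_of_real (2 * q)" for z
  define h where "h z = (if z = 0 then deriv g 0 else (g z - g 0) / (z - 0))" for z
  define E where "E z = h z / (2 - z)" for z
  have pos: "1 - z \<notin> \<real>\<^sub>\<le>\<^sub>0" if "z \<in> ball 0 1" for z :: complex
  proof -
    have "Re z < 1" using that complex_Re_le_cmod[of z] by simp
    then show ?thesis by (auto simp: complex_nonpos_Reals_iff)
  qed
  have g: "g holomorphic_on ball 0 1"
    unfolding g_def by (intro holomorphic_intros) (use pos in auto)
  have "(g has_field_derivative complex_of_real (2 * q)) (at 0)"
    unfolding g_def by (rule derivative_eq_intros refl | simp)+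
  then have dg: "deriv g 0 = complex_of_real (2 * q)" by (rule DERIV_imp_deriv)
  have h: "h holomorphic_on ball 0 1"
    unfolding h_def by (rule pole_lemma[OF g]) simp
  have E: "E holomorphic_on ball 0 1"
    unfolding E_def by (intro holomorphic_intros h) auto
  have "E 0 = of_real q" by (simp add: E_def h_def dg)
  moreover have "isCont E 0"
    using holomorphic_on_imp_continuous_on[OF E] by (simp add: continuous_on_eq_continuous_at)
  then have "((\<lambda>z. Re (E z)) \<longlongrightarrow> Re (E 0)) (nhds 0)"
    by (intro tendsto_Re) (simp add: isCont_def tendsto_at_iff_tendsto_nhds)
  ultimately have "\<forall>\<^sub>F z :: complex in nhds 0. 0 < Re (E z)"
    using q by (intro order_tendstoD(1)[where y = q]) auto
  then obtain r0 where r0: "0 < r0" "\<And>z :: complex. dist z 0 < r0 \<Longrightarrow> 0 < Re (E z)"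
    unfolding eventually_nhds_metric by blast
  define r where "r = min r0 (1 / 2)"
  have r: "0 < r" "r < 1" "r \<le> r0" using r0 by (auto simp: r_def)
  have sub: "ball 0 r \<subseteq> ball (0::complex) 1" using r by auto
  have S: "(\<lambda>z. csqrt (E z)) holomorphic_on ball 0 r"
  proof (intro holomorphic_intros holomorphic_on_subset[OF E sub])
    fix z :: complex assume "z \<in> ball 0 r"
    then have "0 < Re (E z)" using r0(2)[of z] r(3) by (simp add: dist_commute)
    then show "E z \<notin> \<real>\<^sub>\<le>\<^sub>0" by (auto simp: complex_nonpos_Reals_iff)
  qed
  define d where "d k = (deriv ^^ k) (\<lambda>z. csqrt (E z)) 0 / fact k" for k
  have "(\<lambda>k. d k * of_real x ^ k) sums of_real (sqrt ((1 - (1 - x) powr (2 * q)) / (1 - (1 - x)\<^sup>2)))"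
    if x: "0 < x" "x < r" for x :: real
  proof -
    have "(\<lambda>k. d k * (of_real x - 0) ^ k) sums csqrt (E (of_real x))"
      unfolding d_def by (rule holomorphic_power_series[OF S]) (use x in auto)
    moreover have "E (of_real x) = of_real ((1 - (1 - x) powr (2 * q)) / (1 - (1 - x)\<^sup>2))"
    proof -
      have "g (of_real x) = of_real (1 - (1 - x) powr (2 * q))"
        using x r powr_of_real[of "1 - x" "2 * q"] by (simp add: g_def)
      then have "E (of_real x) = of_real ((1 - (1 - x) powr (2 * q)) / x / (2 - x))"
        using x by (simp add: E_def h_def g_def)
      also have "x * (2 - x) = 1 - (1 - x)\<^sup>2" by (simp add: power2_eq_square algebra_simps)
      then have "(1 - (1 - x) powr (2 * q)) / x / (2 - x) = (1 - (1 - x) powr (2 * q)) / (1 - (1 - x)\<^sup>2)"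
        by (simp add: divide_divide_eq_left)
      finally show ?thesis .
    qed
    moreover have "0 \<le> (1 - (1 - x) powr (2 * q)) / (1 - (1 - x)\<^sup>2)"
      using x r q by (intro divide_nonneg_nonneg) (auto simp: powr_le1 power_le_one)
    ultimately show ?thesis by (simp add: csqrt_of_real_nonneg)
  qed
  then show ?thesis using r by blast
qed

text \<open>The quotient of the weights at \<open>x\<^sup>q\<close> and at \<open>x\<close>.\<close>

definition weight_ratio :: "real \<Rightarrow> real \<Rightarrow> real"
  where "weight_ratio q x = sqrt ((1 - x powr (2 * q)) / (1 - x\<^sup>2))"

text \<open>The radius of convergence of the weight determines how far out the tail has to start.\<close>

lemma interpolate_weighted_composition_tail:
  fixes \<mu> :: "nat \<Rightarrow> real" and f :: "complex \<Rightarrow> complex"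
  assumes \<mu>: "\<And>j. 0 \<le> \<mu> j" "\<And>j. \<mu> j < 1" and sm: "summable (\<lambda>j. 1 - \<mu> j)"
    and f: "h2_le f M" and q: "0 < q"
  shows "\<exists>N (\<psi> :: complex \<Rightarrow> complex) M'. h2_le \<psi> M' \<and>
    (\<forall>j\<ge>N. \<psi> (\<mu> j) = of_real (weight_ratio q (\<mu> j)) * f (complex_of_real (\<mu> j powr q)))"
proof -
  obtain d :: "nat \<Rightarrow> complex" and r where r: "0 < r" "r < 1" and
    d: "\<And>x. 0 < x \<Longrightarrow> x < r \<Longrightarrow>
      (\<lambda>k. d k * of_real x ^ k) sums of_real (sqrt ((1 - (1 - x) powr (2 * q)) / (1 - (1 - x)\<^sup>2)))"
    using weight_power_series[OF q] by blast
  define \<epsilon> where "\<epsilon> = r / 2"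
  have eps: "0 \<le> \<epsilon>" "0 < \<epsilon>" "\<epsilon> < 1" "\<epsilon> < r" using r by (auto simp: \<epsilon>_def)
  have "(\<lambda>n. \<Sum>j. 1 - \<mu> (j + n)) \<longlonglongrightarrow> 0" by (rule suminf_exist_split2[OF sm])
  from LIMSEQ_D[OF this, of "\<epsilon>\<^sup>2 / 8"] eps
  obtain N where "norm ((\<Sum>j. 1 - \<mu> (j + N)) - 0) < \<epsilon>\<^sup>2 / 8" by auto
  then have N: "8 * (\<Sum>j. 1 - \<mu> (j + N)) \<le> \<epsilon>\<^sup>2" by simp
  define m where "m j = \<mu> (j + N)" for j
  have sm': "summable (\<lambda>j. 1 - m j)"
    unfolding m_def by (rule summable_ignore_initial_segment[OF sm])
  have m1: "m j < 1" for j using \<mu> by (simp add: m_def)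
  have m_lt: "1 - m j < \<epsilon>" for j
  proof -
    have "(\<Sum>i\<in>{j}. 1 - m i) \<le> (\<Sum>j. 1 - m j)"
      using m1 by (intro sum_le_suminf sm') (auto intro: less_imp_le)
    then have "8 * (1 - m j) \<le> \<epsilon>\<^sup>2" using N by (simp add: m_def)
    moreover have "\<epsilon>\<^sup>2 \<le> 1 * \<epsilon>" unfolding power2_eq_square using eps by (intro mult_right_mono) auto
    ultimately have "8 * (1 - m j) \<le> 1 * \<epsilon>" by (rule order_trans)
    then show ?thesis using eps(2) m1[of j] by simp
  qed
  have m0: "0 < m j" for j using m_lt[of j] eps by linarith
  obtain \<psi>0 :: "complex \<Rightarrow> complex" and M0 where \<psi>0: "h2_le \<psi>0 M0"
    "\<And>j. \<psi>0 (m j) = f (complex_of_real (m j powr q))"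
    using interpolate_composition[where \<mu> = m, OF m0 m1 sm' eps(1,3) N[folded m_def] f q] by blast
  have "summable (\<lambda>k. d k * of_real ((\<epsilon> + r) / 2) ^ k)"
    by (rule sums_summable[OF d]) (use eps in auto)
  then have "summable (\<lambda>k. norm (d k * of_real \<epsilon> ^ k))"
    by (rule powser_insidea) (use eps in \<open>simp del: of_real_add of_real_divide add: norm_of_real\<close>)
  then have "summable (\<lambda>k. norm (d k * of_real \<epsilon> ^ k) * M0)" by (rule summable_mult2)
  then have "summable (\<lambda>k. \<epsilon> ^ k * (cmod (d k) * M0))"
    using eps by (simp add: norm_mult norm_power mult_ac)
  from interpolate_power_series[where \<mu> = m and F = "\<lambda>k z. d k * \<psi>0 z", OF less_imp_le[OF m0] m1 sm' eps(1)
      N[folded m_def] h2_le_cmult[OF \<psi>0(1)] this]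
  obtain \<psi> :: "complex \<Rightarrow> complex" and M' where \<psi>: "h2_le \<psi> M'"
    "\<And>j. (\<lambda>k. complex_of_real (1 - m j) ^ k * (d k * \<psi>0 (m j))) sums \<psi> (m j)" by blast
  have val: "\<psi> (m j) = of_real (weight_ratio q (m j)) * f (complex_of_real (m j powr q))" for j
  proof -
    have "(\<lambda>k. d k * of_real (1 - m j) ^ k) sums of_real (weight_ratio q (m j))"
      using d[of "1 - m j"] m1[of j] m_lt[of j] eps by (simp add: weight_ratio_def)
    from sums_mult2[OF this, of "\<psi>0 (m j)"]
    have "(\<lambda>k. complex_of_real (1 - m j) ^ k * (d k * \<psi>0 (m j))) sums (of_real (weight_ratio q (m j)) * \<psi>0 (m j))"
      by (simp add: mult_ac)
    from sums_unique2[OF \<psi>(2) this] show ?thesis by (simp add: \<psi>0(2))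
  qed
  have "\<psi> (\<mu> j) = of_real (weight_ratio q (\<mu> j)) * f (complex_of_real (\<mu> j powr q))" if "j \<ge> N" for j
    using val[of "j - N"] that by (simp add: m_def)
  with \<psi>(1) show ?thesis by blast
qed

lemma interpolate_weighted_composition:
  fixes \<mu> :: "nat \<Rightarrow> real" and f :: "complex \<Rightarrow> complex"
  assumes \<mu>: "\<And>j. 0 \<le> \<mu> j" "\<And>j. \<mu> j < 1" and sm: "summable (\<lambda>j. 1 - \<mu> j)" and inj: "inj \<mu>"
    and f: "h2_le f M" and q: "0 < q"
  shows "\<exists>(\<psi> :: complex \<Rightarrow> complex) M'. h2_le \<psi> M' \<and>
    (\<forall>j. \<psi> (\<mu> j) = of_real (weight_ratio q (\<mu> j)) * f (complex_of_real (\<mu> j powr q)))"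
proof -
  define v where "v j = of_real (weight_ratio q (\<mu> j)) * f (complex_of_real (\<mu> j powr q))" for j
  obtain N and \<psi>0 :: "complex \<Rightarrow> complex" and M0 where \<psi>0: "h2_le \<psi>0 M0"
    "\<And>j. j \<ge> N \<Longrightarrow> \<psi>0 (\<mu> j) = v j"
    using interpolate_weighted_composition_tail[where \<mu> = \<mu>, OF \<mu> sm f q] unfolding v_def by blast
  have "\<forall>h. \<exists>x :: (complex \<Rightarrow> complex) \<times> real.
      h2_le (fst x) (snd x) \<and> fst x (\<mu> h) = 1 \<and> (\<forall>j. j \<noteq> h \<longrightarrow> fst x (\<mu> j) = 0)"
    using separating_function[where \<mu> = \<mu>, OF \<mu> sm inj] by (simp only: split_paired_Ex fst_conv snd_conv) blast
  then obtain X :: "nat \<Rightarrow> (complex \<Rightarrow> complex) \<times> real" where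
    X: "\<forall>h. h2_le (fst (X h)) (snd (X h)) \<and> fst (X h) (\<mu> h) = 1 \<and> (\<forall>j. j \<noteq> h \<longrightarrow> fst (X h) (\<mu> j) = 0)"
    by (rule choice[THEN exE])
  define w where "w h = v h - \<psi>0 (\<mu> h)" for h
  define \<psi> where "\<psi> z = \<psi>0 z + (\<Sum>h<N. w h * fst (X h) z)" for z
  have "h2_le \<psi> (M0 + (\<Sum>h<N. cmod (w h) * snd (X h)))"
    unfolding \<psi>_def using X by (intro h2_le_add \<psi>0(1) h2_le_sum h2_le_cmult) blast
  moreover have "\<psi> (\<mu> j) = v j" for j
  proof -
    have "(\<Sum>h<N. w h * fst (X h) (\<mu> j)) = (\<Sum>h<N. if h = j then w j else 0)"
      using X by (intro sum.cong) auto
    then show ?thesis using \<psi>0(2)[of j] by (simp add: \<psi>_def w_def)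
  qed
  ultimately show ?thesis unfolding v_def by blast
qed

lemma hardy2_iff: "f \<in> hardy2 \<longleftrightarrow> f \<in> extensional unit_disc \<and> (\<exists>M. h2_le f M)"
proof -
  have "summable (\<lambda>n. (cmod (c n))\<^sup>2) \<longleftrightarrow> (\<exists>M. l2_le c M)" for c
  proof
    assume s: "summable (\<lambda>n. (cmod (c n))\<^sup>2)"
    have "l2_le c (sqrt (\<Sum>n. (cmod (c n))\<^sup>2))"
      using sum_le_suminf[OF s] suminf_nonneg[OF s] by (intro l2_leI) auto
    then show "\<exists>M. l2_le c M" by blast
  qed (auto intro: l2_le_summable)
  then show ?thesis unfolding hardy2_def h2_le_def taylor_def by blast
qed

lemma weighted_eval_ran_powr_subset:
  fixes \<mu> :: "nat \<Rightarrow> real"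
  assumes \<mu>: "\<And>j. 0 \<le> \<mu> j" "\<And>j. \<mu> j < 1" and sm: "summable (\<lambda>j. 1 - \<mu> j)" and inj: "inj \<mu>"
    and q: "0 < q"
  shows "weighted_eval_ran (\<lambda>j. complex_of_real (\<mu> j powr q)) \<subseteq> weighted_eval_ran (\<lambda>j. complex_of_real (\<mu> j))"
proof
  fix x assume "x \<in> weighted_eval_ran (\<lambda>j. complex_of_real (\<mu> j powr q))"
  then obtain \<phi> where \<phi>: "\<phi> \<in> hardy2" "x \<in> ell2 UNIV" "x = weighted_eval (\<lambda>j. complex_of_real (\<mu> j powr q)) \<phi>"
    unfolding weighted_eval_ran_def weighted_eval_dom_def by auto
  then obtain M where "h2_le \<phi> M" unfolding hardy2_iff by blast
  then obtain \<psi>0 :: "complex \<Rightarrow> complex" and M' where \<psi>0: "h2_le \<psi>0 M'"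
    "\<And>j. \<psi>0 (\<mu> j) = of_real (weight_ratio q (\<mu> j)) * \<phi> (complex_of_real (\<mu> j powr q))"
    using interpolate_weighted_composition[where \<mu> = \<mu>, OF \<mu> sm inj _ q] by blast
  define \<psi> where "\<psi> = restrict \<psi>0 unit_disc"
  have "h2_le \<psi> M'" by (rule h2_le_cong[OF \<psi>0(1)]) (simp add: \<psi>_def)
  then have "\<psi> \<in> hardy2" unfolding hardy2_iff by (auto simp: \<psi>_def)
  moreover have "weighted_eval (\<lambda>j. complex_of_real (\<mu> j)) \<psi> = x"
  proof
    fix j
    have sq: "(\<mu> j powr q)\<^sup>2 = \<mu> j powr (2 * q)" by (simp add: power2_eq_square flip: powr_add)
    have "(\<mu> j)\<^sup>2 < 1" using \<mu>[of j] by (simp add: power_less_one_iff)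
    then have "sqrt (1 - (\<mu> j)\<^sup>2) * weight_ratio q (\<mu> j) = sqrt (1 - (\<mu> j powr q)\<^sup>2)"
      unfolding weight_ratio_def sq by (simp flip: real_sqrt_mult)
    from arg_cong[OF this, of complex_of_real]
    have "complex_of_real (sqrt (1 - (\<mu> j)\<^sup>2)) * of_real (weight_ratio q (\<mu> j)) = complex_of_real (sqrt (1 - (\<mu> j powr q)\<^sup>2))"
      by simp
    moreover have "\<psi> (\<mu> j) = \<psi>0 (\<mu> j)" using \<mu>[of j] by (simp add: \<psi>_def)
    ultimately show "weighted_eval (\<lambda>j. complex_of_real (\<mu> j)) \<psi> j = x j"
      unfolding \<phi>(3) weighted_eval_def \<psi>0(2) by (simp add: \<psi>0(2) norm_of_real flip: mult.assoc)
  qed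
  ultimately show "x \<in> weighted_eval_ran (\<lambda>j. complex_of_real (\<mu> j))"
    using \<phi>(2) unfolding weighted_eval_ran_def weighted_eval_dom_def by blast
qed

section \<open>From Carleson sequences to the Blaschke condition\<close>

text \<open>Both follow from the identity
  \<open>1 - \<rho>(w,z)\<^sup>2 = (1 - |w|\<^sup>2) (1 - |z|\<^sup>2) / |1 - cnj w z|\<^sup>2\<close>, as the last denominator is at most 4.\<close>

lemma one_minus_pseudohyp_square:
  assumes "cmod w < 1" "cmod z < 1"
  shows "(1 - (cmod w)\<^sup>2) * (1 - (cmod z)\<^sup>2) \<le> 4 * (1 - (pseudohyp w z)\<^sup>2)"
    and "pseudohyp w z \<le> 1"
proof -
  define D where "D = cmod (1 - cnj w * z)"
  have id: "D\<^sup>2 - (cmod (w - z))\<^sup>2 = (1 - (cmod w)\<^sup>2) * (1 - (cmod z)\<^sup>2)"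
    unfolding D_def cmod_power2 by (simp add: power2_eq_square algebra_simps)
  have wz: "cmod (cnj w * z) < 1"
    using mult_strict_mono'[of "cmod w" 1 "cmod z" 1] assms by (simp add: norm_mult)
  have "D \<noteq> 0"
  proof
    assume "D = 0"
    then have "cnj w * z = 1" by (simp add: D_def)
    with wz show False by simp
  qed
  then have D0: "0 < D" by (simp add: D_def)
  have "D \<le> 2" unfolding D_def using norm_triangle_ineq4[of 1 "cnj w * z"] wz by simp
  then have "D\<^sup>2 \<le> 2\<^sup>2" using D0 by (intro power_mono) auto
  then have D2: "D\<^sup>2 \<le> 4" by simp
  have w1: "0 \<le> 1 - (cmod w)\<^sup>2" "0 \<le> 1 - (cmod z)\<^sup>2" using assms by (auto simp: power_le_one)
  have "(pseudohyp w z)\<^sup>2 = (cmod (w - z))\<^sup>2 / D\<^sup>2"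
    by (simp add: pseudohyp_def D_def norm_divide power_divide)
  then have eq: "1 - (pseudohyp w z)\<^sup>2 = (1 - (cmod w)\<^sup>2) * (1 - (cmod z)\<^sup>2) / D\<^sup>2"
    using D0 by (simp add: field_simps flip: id)
  have "(1 - (cmod w)\<^sup>2) * (1 - (cmod z)\<^sup>2) / 4 \<le> (1 - (cmod w)\<^sup>2) * (1 - (cmod z)\<^sup>2) / D\<^sup>2"
    using w1 D0 D2 by (intro divide_left_mono) auto
  then show "(1 - (cmod w)\<^sup>2) * (1 - (cmod z)\<^sup>2) \<le> 4 * (1 - (pseudohyp w z)\<^sup>2)"
    unfolding eq by linarith
  have "0 \<le> 1 - (pseudohyp w z)\<^sup>2" unfolding eq using w1 by auto
  then have "(pseudohyp w z)\<^sup>2 \<le> 1\<^sup>2" by simp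
  then show "pseudohyp w z \<le> 1" by (rule power2_le_imp_le) simp
qed

text \<open>One of the products in the Carleson condition suffices: positivity of
  \<open>\<Prod>\<^sub>i \<rho>(a\<^sub>i, a\<^sub>0)\<close> makes \<open>1 - \<rho>(a\<^sub>i, a\<^sub>0)\<close> summable, and this is comparable to \<open>1 - |a\<^sub>i|\<close>.\<close>

lemma carleson_seq_blaschke:
  assumes "carleson_seq a" shows "summable (\<lambda>i. 1 - cmod (a i))"
proof -
  have "range a \<subseteq> unit_disc" using assms unfolding carleson_seq_def by blast
  then have a1: "cmod (a i) < 1" for i by (simp add: image_subset_iff)
  define P where "P j n = (\<Prod>i\<in>{..<n} - {j}. pseudohyp (a i) (a j))" for j n
  have rho: "0 \<le> pseudohyp (a i) (a j)" "pseudohyp (a i) (a j) \<le> 1" for i j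
    using one_minus_pseudohyp_square(2)[OF a1 a1] by (auto simp: pseudohyp_def)
  have P0: "0 \<le> P j n" for j n unfolding P_def by (intro prod_nonneg) (use rho in auto)
  have dec: "decseq (P j)" for j
  proof (rule decseq_SucI)
    fix n
    have "{..<Suc n} - {j} = (if n = j then {..<n} - {j} else insert n ({..<n} - {j}))" by auto
    then show "P j (Suc n) \<le> P j n"
      using P0[of j n] rho[of n j] mult_right_mono[of "pseudohyp (a n) (a j)" 1 "P j n"]
      by (simp add: P_def split: if_splits)
  qed
  have lim: "0 \<le> lim (P j)" "lim (P j) \<le> P j n" for j n
  proof -
    obtain L where L: "P j \<longlonglongrightarrow> L" "\<forall>i. L \<le> P j i"
      by (rule decseq_convergent[OF dec[of j], of 0]) (use P0 in auto)
    have "0 \<le> L" using LIMSEQ_le_const[OF L(1)] P0 by blast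
    then show "0 \<le> lim (P j)" "lim (P j) \<le> P j n" using limI[OF L(1)] L(2) by auto
  qed
  have "(INF j. lim (P j)) \<le> lim (P 0)"
    by (rule cINF_lower) (auto intro!: bdd_belowI2[of _ 0] lim)
  moreover have "0 < (INF j. lim (P j))"
    using assms unfolding carleson_seq_def P_def[abs_def] by blast
  ultimately have pos: "0 < lim (P 0)" by linarith
  define x where "x i = 1 - pseudohyp (a i) (a 0)" for i
  have sum_x: "(\<Sum>i\<in>{..<n} - {0}. x i) \<le> - ln (lim (P 0))" for n
  proof -
    have "P 0 n \<le> (\<Prod>i\<in>{..<n} - {0}. exp (- x i))"
      unfolding P_def
    proof (rule prod_mono)
      fix i
      show "0 \<le> pseudohyp (a i) (a 0) \<and> pseudohyp (a i) (a 0) \<le> exp (- x i)"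
        using rho[of i 0] exp_ge_add_one_self[of "- x i"] by (simp add: x_def)
    qed
    also have "\<dots> = exp (- (\<Sum>i\<in>{..<n} - {0}. x i))" by (simp flip: exp_sum add: sum_negf)
    finally have "lim (P 0) \<le> exp (- (\<Sum>i\<in>{..<n} - {0}. x i))" using lim(2)[of 0 n] by linarith
    then have "ln (lim (P 0)) \<le> - (\<Sum>i\<in>{..<n} - {0}. x i)" using pos by (metis exp_gt_zero ln_exp ln_le_cancel_iff)
    then show ?thesis by linarith
  qed
  have "summable x"
  proof (rule summableI_nonneg_bounded[where x = "1 - ln (lim (P 0))"])
    fix n
    show "0 \<le> x n" using rho by (simp add: x_def)
    have "(\<Sum>i<n. x i) \<le> (\<Sum>i\<in>insert 0 ({..<n} - {0}). x i)"
      by (intro sum_mono2) (use rho in \<open>auto simp: x_def\<close>)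
    also have "\<dots> = x 0 + (\<Sum>i\<in>{..<n} - {0}. x i)" by (rule sum.insert) auto
    also have "\<dots> \<le> 1 + - ln (lim (P 0))"
      using sum_x[of n] rho[of 0 0] by (intro add_mono) (auto simp: x_def)
    finally show "(\<Sum>i<n. x i) \<le> 1 - ln (lim (P 0))" by simp
  qed
  define K where "K = 1 - (cmod (a 0))\<^sup>2"
  have K: "0 < K" using a1[of 0] by (simp add: K_def power_less_one_iff)
  have le: "1 - cmod (a i) \<le> 8 / K * x i" for i
  proof -
    have "(cmod (a i))\<^sup>2 \<le> cmod (a i)" using a1[of i] by (simp add: power2_eq_square mult_left_le)
    then have "(1 - cmod (a i)) * K \<le> (1 - (cmod (a i))\<^sup>2) * K" using K by (intro mult_right_mono) auto
    also have "\<dots> \<le> 4 * (1 - (pseudohyp (a i) (a 0))\<^sup>2)"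
      unfolding K_def by (rule one_minus_pseudohyp_square(1)[OF a1 a1])
    also have "1 - (pseudohyp (a i) (a 0))\<^sup>2 = x i * (1 + pseudohyp (a i) (a 0))"
      by (simp add: x_def power2_eq_square algebra_simps)
    also have "4 * (x i * (1 + pseudohyp (a i) (a 0))) \<le> 4 * (x i * 2)"
      using rho[of i 0] by (intro mult_left_mono) (auto simp: x_def)
    finally show ?thesis using K by (simp add: field_simps)
  qed
  show ?thesis
    by (rule summable_comparison_test'[OF summable_mult[OF \<open>summable x\<close>, of "8 / K"], of 0])
      (use le a1 in \<open>auto simp: less_imp_le\<close>)
qed

text \<open>The Carleson sequences that make up the set may overlap and enumerate it in another order, so the
  sums are taken over sets of points.\<close>

lemma finite_union_of_carleson_blaschke:
  fixes l :: "nat \<Rightarrow> complex"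
  assumes "finite_union_of_carleson (range l)" and inj: "inj l"
  shows "summable (\<lambda>j. 1 - cmod (l j))"
proof -
  obtain C where C: "finite C" "\<And>a. a \<in> C \<Longrightarrow> carleson_seq a" "range l = (\<Union>a\<in>C. range a)"
    using assms(1) unfolding finite_union_of_carleson_def by blast
  define h where "h z = 1 - cmod z" for z :: complex
  have one: "h summable_on range a" if "a \<in> C" for a
  proof -
    have "inj a" "range a \<subseteq> unit_disc" using C(2)[OF that] unfolding carleson_seq_def by blast+
    then have a: "\<And>i. cmod (a i) < 1" by (simp add: image_subset_iff)
    have "((\<lambda>i. 1 - cmod (a i)) has_sum (\<Sum>i. 1 - cmod (a i))) UNIV"
      by (rule sums_nonneg_imp_has_sum[OF summable_sums[OF carleson_seq_blaschke[OF C(2)[OF that]]]])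
        (use a in \<open>auto simp: less_imp_le\<close>)
    then have "(h \<circ> a) summable_on UNIV" by (auto simp: summable_on_def h_def o_def)
    then show ?thesis using summable_on_reindex[OF \<open>inj a\<close>] by blast
  qed
  have "h summable_on (\<Union>a\<in>B. range a)" if "finite B" "B \<subseteq> C" for B
    using that
  proof induction
    case (insert a B)
    then have "h summable_on (range a \<union> (\<Union>a\<in>B. range a))"
      by (intro summable_on_union one) auto
    then show ?case by simp
  qed simp
  from this[OF C(1)] have "h summable_on range l" using C(3) by simp
  then have "(h \<circ> l) summable_on UNIV" using summable_on_reindex[OF inj] by blast
  then show ?thesis using summable_on_imp_summable by (simp add: h_def o_def)
qed

text \<open>Bernoulli's inequality for an integral exponent \<open>n \<ge> p\<close> suffices, since \<open>x\<^sup>p \<ge> x\<^sup>n\<close>.\<close>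

lemma summable_one_minus_powr:
  fixes l :: "nat \<Rightarrow> real"
  assumes l: "\<And>j. 0 \<le> l j" "\<And>j. l j < 1" and p: "0 < p" and sm: "summable (\<lambda>j. 1 - l j)"
  shows "summable (\<lambda>j. 1 - l j powr p)"
proof -
  define n where "n = nat \<lceil>p\<rceil>"
  have n: "p \<le> real n" unfolding n_def by linarith
  have bound: "1 - x powr p \<le> real n * (1 - x)" if x: "0 \<le> x" "x < 1" for x
  proof (cases "x = 0")
    case True
    have "0 < real n" using n p by linarith
    then have "1 \<le> real n" by simp
    with True show ?thesis by simp
  next
    case False
    have "1 + real n * (x - 1) \<le> (1 + (x - 1)) ^ n" by (rule Bernoulli_inequality) (use x in simp)
    also have "\<dots> = x powr real n" using x False by (simp add: powr_realpow)
    also have "\<dots> \<le> x powr p" using n x by (intro powr_mono') auto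
    finally show ?thesis by (simp add: algebra_simps)
  qed
  show ?thesis
  proof (rule summable_comparison_test'[OF summable_mult[OF sm, of "real n"], of 0])
    fix j
    have "l j powr p \<le> 1" using l[of j] p by (intro powr_le1) auto
    then show "norm (1 - l j powr p) \<le> real n * (1 - l j)" using bound[OF l] by simp
  qed
qed

section \<open>Equality of the ranges\<close>

lemma weighted_eval_sum_ran_eq:
  "weighted_eval_sum_ran \<gamma> I = {x \<in> extensional (I \<times> UNIV). \<forall>i\<in>I. (\<lambda>j. x (i, j)) \<in> weighted_eval_ran \<gamma>}"
proof (intro equalityI subsetI)
  fix x assume "x \<in> weighted_eval_sum_ran \<gamma> I"
  then obtain \<phi> where \<phi>: "\<phi> \<in> I \<rightarrow>\<^sub>E weighted_eval_dom \<gamma>" "x = weighted_eval_sum \<gamma> I \<phi>"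
    unfolding weighted_eval_sum_ran_def weighted_eval_sum_dom_def by blast
  then have "(\<lambda>j. x (i, j)) = weighted_eval \<gamma> (\<phi> i)" if "i \<in> I" for i
    using that by (simp add: weighted_eval_sum_def)
  with \<phi> show "x \<in> {x \<in> extensional (I \<times> UNIV). \<forall>i\<in>I. (\<lambda>j. x (i, j)) \<in> weighted_eval_ran \<gamma>}"
    by (auto simp: weighted_eval_ran_def weighted_eval_sum_def)
next
  fix x assume x: "x \<in> {x \<in> extensional (I \<times> UNIV). \<forall>i\<in>I. (\<lambda>j. x (i, j)) \<in> weighted_eval_ran \<gamma>}"
  then have "\<forall>i\<in>I. \<exists>\<phi>. \<phi> \<in> weighted_eval_dom \<gamma> \<and> (\<lambda>j. x (i, j)) = weighted_eval \<gamma> \<phi>"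
    unfolding weighted_eval_ran_def by blast
  then obtain \<phi> where \<phi>: "\<forall>i\<in>I. \<phi> i \<in> weighted_eval_dom \<gamma> \<and> (\<lambda>j. x (i, j)) = weighted_eval \<gamma> (\<phi> i)"
    by (rule bchoice[THEN exE])
  have "x = weighted_eval_sum \<gamma> I (restrict \<phi> I)"
  proof
    fix s :: "'a \<times> nat"
    obtain i j where s: "s = (i, j)" by (cases s)
    show "x s = weighted_eval_sum \<gamma> I (restrict \<phi> I) s"
    proof (cases "i \<in> I")
      case True
      then have "x (i, j) = weighted_eval \<gamma> (\<phi> i) j" using \<phi> by metis
      then show ?thesis using True by (simp add: s weighted_eval_sum_def)
    next
      case False
      then show ?thesis using x by (simp add: s weighted_eval_sum_def extensional_def)
    qed
  qed
  moreover have "restrict \<phi> I \<in> weighted_eval_sum_dom \<gamma> I"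
    using \<phi> by (simp add: weighted_eval_sum_dom_def)
  ultimately show "x \<in> weighted_eval_sum_ran \<gamma> I" unfolding weighted_eval_sum_ran_def by blast
qed

theorem theorem4p2:
  fixes l :: "nat \<Rightarrow> real" and p :: real
  assumes "\<And>j. 0 \<le> l j" and "\<And>j. l j < 1"
    and "inj l"
    and "finite_union_of_carleson (range (\<lambda>j. complex_of_real (l j)))"
    and "p > 0"
  shows "weighted_eval_ran (\<lambda>j. complex_of_real (l j)) =
      weighted_eval_ran (\<lambda>j. complex_of_real (l j powr p)) \<and>
    (\<forall>I :: 'i set. finite I \<longrightarrow>
      weighted_eval_sum_ran (\<lambda>j. complex_of_real (l j)) I =
      weighted_eval_sum_ran (\<lambda>j. complex_of_real (l j powr p)) I)"
proof -
  have l: "0 \<le> l j" "l j < 1" for j by (rule assms)+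
  have "inj (\<lambda>j. complex_of_real (l j))" using assms(3) by (simp add: inj_def)
  from finite_union_of_carleson_blaschke[OF assms(4) this]
  have sm: "summable (\<lambda>j. 1 - l j)" using l by simp
  define m where "m j = l j powr p" for j
  have m: "0 \<le> m j" "m j < 1" for j
    using l[of j] powr_less_mono2[of p "l j" 1] assms(5) by (auto simp: m_def)
  have ml: "m j powr (1 / p) = l j" for j
    using l[of j] assms(5) by (simp add: m_def powr_powr)
  have "inj m" using assms(3) ml unfolding inj_def by metis
  have smm: "summable (\<lambda>j. 1 - m j)"
    unfolding m_def by (rule summable_one_minus_powr[OF l assms(5) sm])
  have "weighted_eval_ran (\<lambda>j. complex_of_real (m j)) \<subseteq> weighted_eval_ran (\<lambda>j. complex_of_real (l j))"
    using weighted_eval_ran_powr_subset[OF l sm assms(3,5)] by (simp add: m_def)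
  moreover have "weighted_eval_ran (\<lambda>j. complex_of_real (l j)) \<subseteq> weighted_eval_ran (\<lambda>j. complex_of_real (m j))"
    using weighted_eval_ran_powr_subset[OF m smm \<open>inj m\<close>, of "1 / p"] assms(5) unfolding ml by simp
  ultimately have "weighted_eval_ran (\<lambda>j. complex_of_real (l j)) =
      weighted_eval_ran (\<lambda>j. complex_of_real (l j powr p))"
    unfolding m_def by (rule equalityI[rotated])
  then show ?thesis unfolding weighted_eval_sum_ran_eq by simp
qed

end
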